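(* Let $H_a$ denote the Haj\'os graph and let $F_n$ denote the fan consisting of $n$ triangles sharing a common vertex. Then $R(H_a,F_n)=4n+2$ for every integer $n\ge 111$.
   Context: All graphs are finite and simple. For graphs $G_1,G_2$, the Ramsey number $R(G_1,G_2)$ is the smallest positive integer $N$ such that for every graph $\Gamma$ on $N$ vertices, either $\Gamma$ contains $G_1$ as a (not necessarily induced) subgraph, or the complement $\overline{\Gamma}$ contains $G_2$ as a (not necessarily induced) subgraph. The Haj\'os graph $H_a$ is the graph with six vertices and nine edges obtained from a triangle by adding, for each of its three edges, a new vertex joined to exactly the two endpoints of that edge; explicitly, it has vertices $a,b,c,x,y,z$ and edges $ab,bc,ca,xa,xb,yb,yc,zc,za$. The fan $F_n$ is the graph $K_1+nK_2$ on $2n+1$ vertices, formed by $n$ triangles that share one common vertex and are otherwise vertex-disjoint (that is, a center vertex joined to all $2n$ vertices of a matching with $n$ edges, with no other edges). *)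

theory Defs
  imports "HOL-Library.Ramsey"
begin

text \<open>
  A graph is a pair of a vertex set and a set of unordered edges; an edge is a 2-element set
  of vertices, so that loops and multiple edges are excluded. The library notation
  \<open>[V]\<^bsup>2\<^esup>\<close> is the set of all 2-element subsets of \<open>V\<close>.
\<close>

type_synonym 'a graph = "'a set \<times> 'a set set"

abbreviation verts :: "'a graph \<Rightarrow> 'a set" where
  "verts G \<equiv> fst G"

abbreviation edges :: "'a graph \<Rightarrow> 'a set set" where
  "edges G \<equiv> snd G"

definition simple_graph :: "'a graph \<Rightarrow> bool" where
  "simple_graph G \<longleftrightarrow> finite (verts G) \<and> edges G \<subseteq> [verts G]\<^bsup>2\<^esup>"

definition graph_complement :: "'a graph \<Rightarrow> 'a graph" where
  "graph_complement G = (verts G, [verts G]\<^bsup>2\<^esup> - edges G)"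

text \<open>\<open>G\<close> has a (not necessarily induced) subgraph isomorphic to \<open>H\<close>.\<close>

definition contains_graph :: "'a graph \<Rightarrow> 'b graph \<Rightarrow> bool" where
  "contains_graph G H \<longleftrightarrow>
     (\<exists>f. inj_on f (verts H) \<and> f ` verts H \<subseteq> verts G \<and> (\<forall>e\<in>edges H. f ` e \<in> edges G))"

text \<open>
  Every finite graph has an isomorphic copy with vertices in \<open>nat\<close>, so it suffices to
  quantify over those; see \<open>ramsey_bound_any_type\<close> below.
\<close>

definition ramsey_bound :: "'a graph \<Rightarrow> 'b graph \<Rightarrow> nat \<Rightarrow> bool" where
  "ramsey_bound G1 G2 N \<longleftrightarrow>
     (\<forall>\<Gamma> :: nat graph. simple_graph \<Gamma> \<and> card (verts \<Gamma>) = N \<longrightarrow>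
        contains_graph \<Gamma> G1 \<or> contains_graph (graph_complement \<Gamma>) G2)"

text \<open>The minimum exists by Ramsey's theorem; see \<open>ramsey_number_least\<close> below.\<close>

definition ramsey_number :: "'a graph \<Rightarrow> 'b graph \<Rightarrow> nat" where
  "ramsey_number G1 G2 = (LEAST N. N > 0 \<and> ramsey_bound G1 G2 N)"

text \<open>
  The vertices \<open>a, b, c, x, y, z\<close> are numbered \<open>0, \<dots>, 5\<close>: the triangle is \<open>{0, 1, 2}\<close>, and
  \<open>3, 4, 5\<close> are attached to the edges \<open>{0, 1}\<close>, \<open>{1, 2}\<close>, \<open>{2, 0}\<close>.
\<close>

definition hajos_graph :: "nat graph" where
  "hajos_graph =
     ({0, 1, 2, 3, 4, 5},
      {{0, 1}, {1, 2}, {2, 0}, {3, 0}, {3, 1}, {4, 1}, {4, 2}, {5, 2}, {5, 0}})"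

text \<open>The centre is \<open>0\<close>; the matching on the other vertices is \<open>{1, 2}, {3, 4}, \<dots>\<close>.\<close>

definition fan_graph :: "nat \<Rightarrow> nat graph" where
  "fan_graph n =
     ({0..2 * n}, {{0, i} |i. i \<in> {1..2 * n}} \<union> {{2 * i + 1, 2 * i + 2} |i. i < n})"

lemma simple_hajos_graph: "simple_graph hajos_graph"
  by (auto simp: simple_graph_def hajos_graph_def nsets_def)

lemma simple_fan_graph: "simple_graph (fan_graph n)"
  by (auto simp: simple_graph_def fan_graph_def nsets_def)

lemma contains_graph_clique:
  assumes "simple_graph H" "finite R" "R \<subseteq> verts G" "card R = card (verts H)"
    and "[R]\<^bsup>2\<^esup> \<subseteq> edges G"
  shows "contains_graph G H"
proof -
  obtain f where f: "bij_betw f (verts H) R"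
    using assms finite_same_card_bij unfolding simple_graph_def by metis
  have inj: "inj_on f (verts H)" and im: "f ` verts H = R"
    using f by (auto simp: bij_betw_def)
  have "f ` e \<in> edges G" if "e \<in> edges H" for e
  proof -
    have e: "e \<subseteq> verts H" "finite e" "card e = 2"
      using that assms(1) by (auto simp: simple_graph_def nsets_def)
    then have "card (f ` e) = 2"
      using inj by (metis card_image inj_on_subset)
    then have "f ` e \<in> [R]\<^bsup>2\<^esup>"
      using e im by (auto simp: nsets_def)
    then show ?thesis using assms(5) by blast
  qed
  then show ?thesis
    using inj im assms(3) unfolding contains_graph_def by blast
qed

lemma ramsey_bound_exists:
  assumes "simple_graph G1" "simple_graph G2"
  shows "\<exists>N>0. ramsey_bound G1 G2 N"
proof -
  obtain r where "r \<ge> 1" and r: "\<And>(V :: nat set) (E :: nat set set).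
      finite V \<and> card V \<ge> r \<Longrightarrow>
      \<exists>R \<subseteq> V. card R = card (verts G1) \<and> clique R E \<or> card R = card (verts G2) \<and> indep R E"
    using ramsey2[of "card (verts G1)" "card (verts G2)"] by blast
  have "contains_graph \<Gamma> G1 \<or> contains_graph (graph_complement \<Gamma>) G2"
    if "simple_graph \<Gamma>" "card (verts \<Gamma>) = r" for \<Gamma> :: "nat graph"
  proof -
    have fin: "finite (verts \<Gamma>)" using that by (simp add: simple_graph_def)
    have "\<exists>R \<subseteq> verts \<Gamma>. card R = card (verts G1) \<and> clique R (edges \<Gamma>) \<or>
        card R = card (verts G2) \<and> indep R (edges \<Gamma>)"
      using r fin that(2) by simp
    then obtain R where R: "R \<subseteq> verts \<Gamma>"
      and c: "card R = card (verts G1) \<and> clique R (edges \<Gamma>) \<or>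
        card R = card (verts G2) \<and> indep R (edges \<Gamma>)"
      by (elim exE conjE)
    have finR: "finite R" using R fin finite_subset by blast
    from c show ?thesis
    proof
      assume *: "card R = card (verts G1) \<and> clique R (edges \<Gamma>)"
      then have "[R]\<^bsup>2\<^esup> \<subseteq> edges \<Gamma>"
        by (auto simp: clique_def nsets_def card_2_iff)
      then show ?thesis using contains_graph_clique assms(1) finR R * by blast
    next
      assume *: "card R = card (verts G2) \<and> indep R (edges \<Gamma>)"
      then have "[R]\<^bsup>2\<^esup> \<subseteq> edges (graph_complement \<Gamma>)"
        using R by (auto simp: indep_def nsets_def card_2_iff graph_complement_def)
      moreover have "R \<subseteq> verts (graph_complement \<Gamma>)"
        using R by (simp add: graph_complement_def)
      ultimately show ?thesis using contains_graph_clique assms(2) finR * by blast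
    qed
  qed
  then show ?thesis
    using \<open>r \<ge> 1\<close> unfolding ramsey_bound_def by (intro exI[of _ r]) auto
qed

lemma ramsey_number_least:
  assumes "simple_graph G1" "simple_graph G2"
  shows "ramsey_number G1 G2 > 0" "ramsey_bound G1 G2 (ramsey_number G1 G2)"
    and "\<And>N. N > 0 \<Longrightarrow> ramsey_bound G1 G2 N \<Longrightarrow> ramsey_number G1 G2 \<le> N"
  using LeastI_ex[OF ramsey_bound_exists[OF assms]]
  unfolding ramsey_number_def by (auto intro: Least_le)

lemma ramsey_bound_any_type:
  fixes \<Gamma> :: "'c graph"
  assumes bound: "ramsey_bound G1 G2 N"
    and \<Gamma>: "simple_graph \<Gamma>" "card (verts \<Gamma>) = N"
  shows "contains_graph \<Gamma> G1 \<or> contains_graph (graph_complement \<Gamma>) G2"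
proof -
  obtain g where g: "bij_betw g {0..<N} (verts \<Gamma>)"
    using \<Gamma> ex_bij_betw_nat_finite unfolding simple_graph_def by blast
  then have inj: "inj_on g {0..<N}" and im: "g ` {0..<N} = verts \<Gamma>"
    by (auto simp: bij_betw_def)
  have g2: "g ` e \<in> [verts \<Gamma>]\<^bsup>2\<^esup>" if "e \<in> [{0..<N}]\<^bsup>2\<^esup>" for e
    using that inj im by (auto simp: nsets_def card_image inj_on_subset)
  define \<Delta> :: "nat graph" where "\<Delta> = ({0..<N}, {e \<in> [{0..<N}]\<^bsup>2\<^esup>. g ` e \<in> edges \<Gamma>})"
  have *: "contains_graph G H"
    if D: "contains_graph D H" "verts D = {0..<N}" "verts G = verts \<Gamma>"
      "\<And>e. e \<in> edges D \<Longrightarrow> g ` e \<in> edges G"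
    for D :: "nat graph" and G :: "'c graph" and H :: "'d graph"
  proof -
    obtain f where f: "inj_on f (verts H)" "f ` verts H \<subseteq> {0..<N}" "\<forall>e\<in>edges H. f ` e \<in> edges D"
      using D(1,2) unfolding contains_graph_def by auto
    then have "inj_on (g \<circ> f) (verts H)"
      using comp_inj_on[OF f(1) inj_on_subset[OF inj f(2)]] by simp
    moreover have "(g \<circ> f) ` verts H \<subseteq> verts G"
      using f im D(3) by auto
    moreover have "\<forall>e\<in>edges H. (g \<circ> f) ` e \<in> edges G"
      using f(3) D(4) unfolding image_comp[symmetric] by simp
    ultimately show ?thesis unfolding contains_graph_def by blast
  qed
  have "simple_graph \<Delta>" "card (verts \<Delta>) = N"
    by (auto simp: \<Delta>_def simple_graph_def)
  then have "contains_graph \<Delta> G1 \<or> contains_graph (graph_complement \<Delta>) G2"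
    using bound unfolding ramsey_bound_def by blast
  then show ?thesis
  proof
    assume "contains_graph \<Delta> G1"
    then have "contains_graph \<Gamma> G1"
      by (rule *) (simp_all add: \<Delta>_def)
    then show ?thesis ..
  next
    assume "contains_graph (graph_complement \<Delta>) G2"
    then have "contains_graph (graph_complement \<Gamma>) G2"
      by (rule *) (simp_all add: \<Delta>_def graph_complement_def g2)
    then show ?thesis ..
  qed
qed

end

theory Submission
  imports Defs
begin

text \<open>
  Lower bound. The join of one vertex with the complete bipartite graph \<open>K(2n, 2n)\<close> has
  \<open>4n + 1\<close> vertices. Each of its triangles contains the joined vertex, whereas no vertex of
  the Hajos graph lies on all of its triangles. The components of its complement are complete
  graphs on at most \<open>2n\<close> vertices, too small for a fan with \<open>2n + 1\<close> vertices.

  Upper bound. Let a graph on \<open>4n + 2\<close> vertices contain no Hajos graph, and let its complement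
  contain no fan \<open>F\<^sub>n\<close>. The first condition says that the three edges of a triangle never have
  distinct further common neighbours attached to them. The second says that no \<open>2n\<close>
  non-neighbours of a vertex can be perfectly matched by non-edges. Fans are found in sets
  that induce a star forest, up to a few vertices, because the complement of a star forest is
  rich in edges.

  All degrees are at least \<open>2n\<close> (\<open>degree_ge\<close>), that is, roughly half of the number of
  vertices, and a Hajos-free graph with such degrees must be almost bipartite. Concretely, an
  edge in several triangles yields two vertices with nearly \<open>2n\<close> common neighbours, and the
  common neighbourhood of two vertices contains no path on four vertices. This gives a core:
  disjoint star forests \<open>A\<close> and \<open>B\<close> that cover all but 18 vertices (\<open>core_exists\<close>).

  The heart of the proof is that no vertex \<open>z\<close> has many neighbours in both \<open>A\<close> and \<open>B\<close>
  (\<open>core_separates\<close>). For if \<open>a \<in> A\<close> and \<open>b \<in> B\<close> are suitable adjacent neighbours of \<open>z\<close>, then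
  \<open>z\<close> is their only common neighbour. So each of the remaining \<open>4n - 1\<close> vertices is a
  non-neighbour of \<open>a\<close> or of \<open>b\<close>, and one of the two has \<open>2n\<close> non-neighbours, which turn out
  to be matchable: a fan.

  Hence the whole vertex set splits into two sides that are star forests with most of the
  edges between them. Fan-freeness bounds each side by \<open>2n + 1\<close> vertices, so both have exactly
  that size and no vertex is isolated in its side. Since \<open>2n + 1\<close> is odd, some side contains a
  star with two leaves, and this star together with an edge of the other side produces a Hajos
  graph or a fan (\<open>no_sparse_split\<close>).
\<close>

section \<open>Matchings and maximum matchings\<close>

text \<open>
  A perfect matching of \<open>S\<close> by \<open>R\<close>-edges is encoded by the involution that swaps partners.
  With this encoding, deleting a pair keeps the involution, and adding a pair is a function
  update.
\<close>

definition pairing :: "('a \<Rightarrow> 'a \<Rightarrow> bool) \<Rightarrow> ('a \<Rightarrow> 'a) \<Rightarrow> 'a set \<Rightarrow> bool" where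
  "pairing R \<sigma> S \<longleftrightarrow> (\<forall>w\<in>S. \<sigma> w \<in> S \<and> \<sigma> w \<noteq> w \<and> \<sigma> (\<sigma> w) = w \<and> R w (\<sigma> w))"

definition matchable :: "('a \<Rightarrow> 'a \<Rightarrow> bool) \<Rightarrow> 'a set \<Rightarrow> bool" where
  "matchable R S \<longleftrightarrow> (\<exists>\<sigma>. pairing R \<sigma> S)"

lemma matchable_empty [simp]: "matchable R {}"
  by (simp add: matchable_def pairing_def)

lemma pairing_remove:
  assumes "pairing R \<sigma> S" "w \<in> S"
  shows "pairing R \<sigma> (S - {w, \<sigma> w})"
  using assms unfolding pairing_def by (metis DiffD1 DiffD2 DiffI insertCI insertE singletonD)

lemma matchable_insert_pair:
  assumes "matchable R S" "u \<notin> S" "v \<notin> S" "u \<noteq> v" "R u v" "R v u"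
  shows "matchable R (insert u (insert v S))"
proof -
  obtain \<sigma> where "pairing R \<sigma> S"
    using assms(1) by (auto simp: matchable_def)
  then have "pairing R (\<sigma>(u := v, v := u)) (insert u (insert v S))"
    using assms(2-) unfolding pairing_def by auto
  then show ?thesis by (auto simp: matchable_def)
qed

lemma pairing_card:
  assumes "pairing R \<sigma> S" "w \<in> S" "finite S"
  shows "card S = card (S - {w, \<sigma> w}) + 2"
proof -
  have "{w, \<sigma> w} \<subseteq> S" "card {w, \<sigma> w} = 2"
    using assms by (auto simp: pairing_def card_2_iff)
  then show ?thesis
    using assms(3) by (metis card_Diff_subset card_mono finite_subset le_add_diff_inverse2)
qed

lemma matchable_even:
  assumes "finite S" "matchable R S"
  shows "even (card S)"
proof -
  obtain \<sigma> where "pairing R \<sigma> S"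
    using assms(2) by (auto simp: matchable_def)
  with assms(1) show ?thesis
  proof (induction "card S" arbitrary: S rule: less_induct)
    case less
    show ?case
    proof (cases "S = {}")
      case False
      then obtain w where w: "w \<in> S" by auto
      have "even (card (S - {w, \<sigma> w}))"
        using less.hyps[of "S - {w, \<sigma> w}"] less.prems pairing_remove[OF less.prems(2) w]
          pairing_card[OF less.prems(2) w less.prems(1)] by simp
      then show ?thesis
        using pairing_card[OF less.prems(2) w less.prems(1)] by simp
    qed simp
  qed
qed

lemma matchable_subset_card:
  assumes "finite S" "matchable R S" "2 * k \<le> card S"
  obtains T where "T \<subseteq> S" "matchable R T" "card T = 2 * k"
proof -
  obtain \<sigma> where "pairing R \<sigma> S"
    using assms(2) by (auto simp: matchable_def)
  with assms(1,3) have "\<exists>T\<subseteq>S. matchable R T \<and> card T = 2 * k"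
  proof (induction "card S" arbitrary: S rule: less_induct)
    case less
    show ?case
    proof (cases "card S = 2 * k")
      case True
      then show ?thesis using less.prems by (auto simp: matchable_def)
    next
      case False
      then have "S \<noteq> {}" using less.prems by auto
      then obtain w where w: "w \<in> S" by auto
      have ev: "even (card S)"
        using matchable_even less.prems by (auto simp: matchable_def)
      have "\<exists>T\<subseteq>S - {w, \<sigma> w}. matchable R T \<and> card T = 2 * k"
        using less.prems False ev pairing_remove[OF less.prems(3) w]
          pairing_card[OF less.prems(3) w less.prems(1)]
        by (intro less.hyps) (auto elim!: evenE)
      then show ?thesis by blast
    qed
  qed
  then show thesis using that by blast
qed

lemma matchable_enumeration:
  assumes "finite S" "matchable R S" "card S = 2 * k"
  shows "\<exists>h. inj_on h {1..2 * k} \<and> h ` {1..2 * k} = S \<and> (\<forall>i<k. R (h (2 * i + 1)) (h (2 * i + 2)))"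
proof -
  obtain \<sigma> where "pairing R \<sigma> S"
    using assms(2) by (auto simp: matchable_def)
  with assms(1,3) show ?thesis
  proof (induction k arbitrary: S)
    case 0
    then show ?case by auto
  next
    case (Suc k)
    then have "S \<noteq> {}" by auto
    then obtain w where w: "w \<in> S" by auto
    let ?T = "S - {w, \<sigma> w}"
    have "card ?T = 2 * k"
      using pairing_card[OF Suc.prems(3) w Suc.prems(1)] Suc.prems(2) by simp
    then obtain h where h: "inj_on h {1..2 * k}" "h ` {1..2 * k} = ?T"
        "\<forall>i<k. R (h (2 * i + 1)) (h (2 * i + 2))"
      using Suc.IH[of ?T] Suc.prems pairing_remove[OF Suc.prems(3) w] by auto
    define h' where "h' = h(2 * k + 1 := w, 2 * k + 2 := \<sigma> w)"
    have w2: "\<sigma> w \<in> S" "\<sigma> w \<noteq> w" "R w (\<sigma> w)"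
      using Suc.prems(3) w by (auto simp: pairing_def)
    have old: "h' i = h i" if "i \<le> 2 * k" for i
      using that by (simp add: h'_def)
    have set: "{1..2 * Suc k} = insert (2 * k + 2) (insert (2 * k + 1) {1..2 * k})"
      by auto
    have im: "h' ` {1..2 * k} = ?T"
      using h(2) old by (metis (no_types, lifting) atLeastAtMost_iff image_cong)
    have inj: "inj_on h' {1..2 * k}"
      using h(1) old by (metis (no_types, lifting) atLeastAtMost_iff inj_on_cong)
    have new: "h' (2 * k + 1) = w" "h' (2 * k + 2) = \<sigma> w"
      by (auto simp: h'_def)
    have "inj_on h' {1..2 * Suc k}"
      unfolding set using inj im new w2 by (subst inj_on_insert)+ auto
    moreover have "h' ` {1..2 * Suc k} = S"
      unfolding set image_insert im new using w w2 by auto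
    moreover have "R (h' (2 * i + 1)) (h' (2 * i + 2))" if "i < Suc k" for i
    proof (cases "i = k")
      case True
      then show ?thesis using new w2 by simp
    next
      case False
      then have "i < k" using that by simp
      then show ?thesis using h(3) old[of "2 * i + 1"] old[of "2 * i + 2"] by auto
    qed
    ultimately show ?case by blast
  qed
qed

text \<open>
  What maximality says about the unmatched vertices: they are pairwise unrelated, and no
  augmenting path of length three exists.
\<close>

lemma maximum_pairing:
  assumes "finite S" and sym: "\<And>x y. R x y \<Longrightarrow> R y x"
  obtains T \<sigma> where "T \<subseteq> S" "pairing R \<sigma> T"
    and "\<And>u v. u \<in> S - T \<Longrightarrow> v \<in> S - T \<Longrightarrow> u \<noteq> v \<Longrightarrow> \<not> R u v"
    and "\<And>u v w. u \<in> S - T \<Longrightarrow> v \<in> S - T \<Longrightarrow> u \<noteq> v \<Longrightarrow> w \<in> T \<Longrightarrow> R u w \<Longrightarrow> \<not> R v (\<sigma> w)"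
proof -
  have "\<exists>T. (T \<subseteq> S \<and> matchable R T) \<and> (\<forall>T'. T' \<subseteq> S \<and> matchable R T' \<longrightarrow> card T' \<le> card T)"
    using assms(1) ex_has_greatest_nat[of "\<lambda>T. T \<subseteq> S \<and> matchable R T" "{}" card "Suc (card S)"]
    by (auto simp: less_Suc_eq_le card_mono)
  then obtain T where T: "T \<subseteq> S" "matchable R T"
    and max: "\<And>T'. T' \<subseteq> S \<Longrightarrow> matchable R T' \<Longrightarrow> card T' \<le> card T"
    by blast
  obtain \<sigma> where \<sigma>: "pairing R \<sigma> T"
    using T(2) by (auto simp: matchable_def)
  have fin: "finite T" using T(1) assms(1) finite_subset by blast
  have "\<not> R u v" if "u \<in> S - T" "v \<in> S - T" "u \<noteq> v" for u v
  proof
    assume "R u v"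
    have "matchable R (insert u (insert v T))"
      by (rule matchable_insert_pair) (use that T(2) sym \<open>R u v\<close> in auto)
    then show False
      using max[of "insert u (insert v T)"] that T(1) fin by auto
  qed
  moreover have "\<not> R v (\<sigma> w)"
    if "u \<in> S - T" "v \<in> S - T" "u \<noteq> v" "w \<in> T" "R u w" for u v w
  proof
    assume "R v (\<sigma> w)"
    have w: "\<sigma> w \<in> T" "\<sigma> w \<noteq> w" using \<sigma> \<open>w \<in> T\<close> by (auto simp: pairing_def)
    let ?T = "T - {w, \<sigma> w}"
    have "matchable R ?T"
      using pairing_remove[OF \<sigma> \<open>w \<in> T\<close>] by (auto simp: matchable_def)
    then have 1: "matchable R (insert u (insert w ?T))"
      by (rule matchable_insert_pair) (use that sym in auto)
    have "matchable R (insert v (insert (\<sigma> w) (insert u (insert w ?T))))"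
      by (rule matchable_insert_pair[OF 1]) (use that sym w \<open>R v (\<sigma> w)\<close> in auto)
    moreover have "insert v (insert (\<sigma> w) (insert u (insert w ?T))) = insert u (insert v T)"
      using w that by auto
    ultimately show False
      using max[of "insert u (insert v T)"] that T(1) fin by auto
  qed
  ultimately show thesis using that T(1) \<sigma> by blast
qed

lemma ex_outside_two:
  assumes "finite M1" "finite M2" "card M1 + card M2 < card P"
  obtains x where "x \<in> P" "x \<notin> M1" "x \<notin> M2"
proof -
  have "\<not> P \<subseteq> M1 \<union> M2"
    using assms card_mono[of "M1 \<union> M2" P] card_Un_le[of M1 M2] by auto
  then show thesis using that by blast
qed

section \<open>Star forests\<close>

locale graph =
  fixes V :: "'a set" and adj :: "'a \<Rightarrow> 'a \<Rightarrow> bool"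
  assumes finite_V: "finite V"
    and adj_sym: "adj u v \<Longrightarrow> adj v u"
    and adj_irrefl: "\<not> adj v v"
    and adj_in_V: "adj u v \<Longrightarrow> u \<in> V"
begin

abbreviation nonadj :: "'a \<Rightarrow> 'a \<Rightarrow> bool" where
  "nonadj u v \<equiv> \<not> adj u v"

definition nb :: "'a \<Rightarrow> 'a set" where
  "nb v = {w. adj v w}"

lemma nb_iff [simp]: "w \<in> nb v \<longleftrightarrow> adj v w"
  by (simp add: nb_def)

lemma nb_subset: "nb v \<subseteq> V"
  using adj_in_V adj_sym by (meson nb_iff subsetI)

lemma finite_nb [simp]: "finite (nb v)"
  using nb_subset finite_V finite_subset by blast

text \<open>
  The components of the graph induced on \<open>A\<close> are stars (possibly single vertices or edges).
\<close>

definition star_forest :: "'a set \<Rightarrow> bool" where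
  "star_forest A \<longleftrightarrow> (\<forall>u\<in>A. \<forall>v\<in>A. adj u v \<longrightarrow> nb u \<inter> A = {v} \<or> nb v \<inter> A = {u})"

lemma star_forest_subset: "star_forest A \<Longrightarrow> C \<subseteq> A \<Longrightarrow> star_forest C"
  unfolding star_forest_def by blast

text \<open>
  A star forest has few edges, so its complement has a perfect matching unless one star is
  almost everything. Two unmatched vertices would form an edge from a leaf \<open>v\<close> to its centre
  \<open>u\<close>. If \<open>w\<close> is a non-neighbour of \<open>u\<close>, then the pair of \<open>w\<close> can be exchanged for two pairs,
  \<open>u\<close> with \<open>w\<close> and \<open>v\<close> with the old partner of \<open>w\<close>, since \<open>u\<close> is the only neighbour of \<open>v\<close>.
\<close>

lemma star_forest_matchable:
  assumes fin: "finite C" and sf: "star_forest C" and ev: "even (card C)"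
    and non: "\<And>v. v \<in> C \<Longrightarrow> card (C - nb v) \<ge> 2"
  shows "matchable nonadj C"
proof -
  obtain T \<sigma> where T: "T \<subseteq> C" "pairing nonadj \<sigma> T"
    and un: "\<And>u v. u \<in> C - T \<Longrightarrow> v \<in> C - T \<Longrightarrow> u \<noteq> v \<Longrightarrow> \<not> nonadj u v"
    and ex: "\<And>u v w. u \<in> C - T \<Longrightarrow> v \<in> C - T \<Longrightarrow> u \<noteq> v \<Longrightarrow> w \<in> T \<Longrightarrow> nonadj u w \<Longrightarrow> \<not> nonadj v (\<sigma> w)"
    by (rule maximum_pairing[of C nonadj]) (use fin adj_sym in auto)
  have no: False if u: "u \<in> C - T" and v: "v \<in> C - T" "u \<noteq> v" and leaf: "nb v \<inter> C = {u}" for u v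
  proof -
    have "\<not> C - nb u \<subseteq> {u}"
    proof
      assume "C - nb u \<subseteq> {u}"
      then have "card (C - nb u) \<le> 1" using card_mono[of "{u}" "C - nb u"] by simp
      then show False using non[of u] u by simp
    qed
    then obtain w where w: "w \<in> C" "nonadj u w" "w \<noteq> u" by (auto simp: subset_iff)
    have uv: "adj u v" using un u v by blast
    show False
    proof (cases "w \<in> T")
      case True
      then have "\<sigma> w \<in> T" "\<sigma> w \<in> nb v \<inter> C"
        using ex[OF u v True w(2)] T by (auto simp: pairing_def)
      then show False using leaf u by (metis DiffD2 singletonD)
    next
      case False
      then have "w \<in> nb v \<inter> C" using un[of v w] v w uv by auto
      then show False using leaf w(3) by (metis singletonD)
    qed
  qed
  have finT: "finite T" using T(1) fin finite_subset by blast
  have "even (card T)" using matchable_even[OF finT] T(2) by (auto simp: matchable_def)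
  then have evd: "even (card (C - T))"
    using ev T(1) finT fin by (simp add: card_Diff_subset card_mono)
  have "C - T = {}"
  proof (rule ccontr)
    assume "C - T \<noteq> {}"
    then obtain u where u: "u \<in> C - T" by auto
    have "C - T \<noteq> {u}" using evd by auto
    then obtain v where v: "v \<in> C - T" "u \<noteq> v" using u by auto
    have "adj u v" using un u v by blast
    then have "nb u \<inter> C = {v} \<or> nb v \<inter> C = {u}"
      using sf u v by (auto simp: star_forest_def)
    then show False using no[OF u v] no[OF v(1) u] v(2) by auto
  qed
  then have "T = C" using T(1) by auto
  then show ?thesis using T(2) by (auto simp: matchable_def)
qed

text \<open>
  A few extra vertices \<open>E\<close> without any structure do no harm if each has many non-neighbours in
  the star forest: they are matched greedily first, and the numerical condition survives each
  step.
\<close>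

lemma star_forest_plus_matchable:
  assumes "finite E" "finite C" "star_forest C" "C \<inter> E = {}" "even (card (C \<union> E))"
    and "\<And>v. v \<in> C \<union> E \<Longrightarrow> card (C - nb v) \<ge> card E + 2"
  shows "matchable nonadj (C \<union> E)"
  using assms
proof (induction E arbitrary: C rule: finite_induct)
  case empty
  have "matchable nonadj C"
    by (rule star_forest_matchable) (use empty in \<open>auto simp: numeral_2_eq_2\<close>)
  then show ?case by simp
next
  case (insert e E)
  have "card (C - nb e) \<ge> 2"
    using insert.prems(5)[of e] by simp
  then obtain c where c: "c \<in> C" "nonadj e c"
    by (metis Diff_iff card.empty ex_in_conv le_zero_eq nb_iff zero_neq_numeral)
  have eC: "e \<notin> C" using insert.prems(3) by auto
  have "C \<union> insert e E = insert c (insert e ((C - {c}) \<union> E))"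
    using c by auto
  moreover have "card (insert c (insert e ((C - {c}) \<union> E))) = card ((C - {c}) \<union> E) + 2"
    using c eC insert by (subst card_insert_disjoint; auto)+
  ultimately have eq: "C \<union> insert e E = insert c (insert e ((C - {c}) \<union> E))"
    and ev: "even (card ((C - {c}) \<union> E))"
    using insert.prems(4) by auto
  have "matchable nonadj ((C - {c}) \<union> E)"
  proof (rule insert.IH)
    show "finite (C - {c})" using insert.prems by simp
    show "star_forest (C - {c})"
      using insert.prems(2) star_forest_subset by blast
    show "(C - {c}) \<inter> E = {}" using insert.prems(3) by auto
    show "even (card ((C - {c}) \<union> E))" by (rule ev)
    fix v assume "v \<in> C - {c} \<union> E"
    then have "card (C - nb v) \<ge> card E + 3"
      using insert.prems(5)[of v] insert.hyps by auto
    moreover have "C - nb v \<subseteq> insert c (C - {c} - nb v)" by auto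
    then have "card (C - nb v) \<le> card (insert c (C - {c} - nb v))"
      using insert.prems(1) by (intro card_mono) auto
    moreover have "card (insert c (C - {c} - nb v)) \<le> card (C - {c} - nb v) + 1"
      using insert.prems(1) by (simp add: card_insert_if)
    ultimately show "card E + 2 \<le> card (C - {c} - nb v)" by simp
  qed
  then have "matchable nonadj (insert c (insert e ((C - {c}) \<union> E)))"
    by (rule matchable_insert_pair) (use c eC insert.hyps(2) insert.prems(3) adj_sym in auto)
  then show ?case using eq by simp
qed

end

section \<open>A hypothetical extremal graph\<close>

lemma obtain_outside:
  assumes "finite M" "card M < card P"
  obtains x where "x \<in> P" "x \<notin> M"
proof -
  have "\<not> P \<subseteq> M" using assms card_mono[of M P] by auto
  then show thesis using that by blast
qed

lemma obtain_three:
  assumes "card P \<ge> 3"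
  obtains x y z where "x \<in> P" "y \<in> P" "z \<in> P" "x \<noteq> y" "y \<noteq> z" "x \<noteq> z"
proof -
  obtain Q where "Q \<subseteq> P" "card Q = 3" using obtain_subset_with_card_n[OF assms] by blast
  then show thesis using that by (auto simp: card_3_iff)
qed

lemma obtain_two:
  assumes "card P \<ge> 2"
  obtains x y where "x \<in> P" "y \<in> P" "x \<noteq> y"
proof -
  obtain Q where "Q \<subseteq> P" "card Q = 2" using obtain_subset_with_card_n[OF assms] by blast
  then show thesis using that by (auto simp: card_2_iff)
qed

text \<open>
  A counterexample to the upper bound. The forbidden subgraphs appear in the form in which
  they are used: no triangle \<open>a, b, c\<close> has distinct further vertices attached to its three
  edges, and no vertex has \<open>2n\<close> non-neighbours that are perfectly matched by non-edges. The
  development in this locale ends in a contradiction.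
\<close>

locale critical_graph = graph V adj for V :: "'a set" and adj +
  fixes n :: nat
  assumes n_ge: "n \<ge> 111" and card_V: "card V = 4 * n + 2"
    and no_hajos: "adj a b \<Longrightarrow> adj b c \<Longrightarrow> adj c a \<Longrightarrow> adj x a \<Longrightarrow> adj x b \<Longrightarrow> adj y b \<Longrightarrow> adj y c \<Longrightarrow>
      adj z c \<Longrightarrow> adj z a \<Longrightarrow> x \<noteq> c \<Longrightarrow> y \<noteq> a \<Longrightarrow> z \<noteq> b \<Longrightarrow> x \<noteq> y \<Longrightarrow> y \<noteq> z \<Longrightarrow> x \<noteq> z \<Longrightarrow> False"
    and no_fan: "v \<in> V \<Longrightarrow> v \<notin> S \<Longrightarrow> S \<subseteq> V \<Longrightarrow> S \<inter> nb v = {} \<Longrightarrow> matchable nonadj S \<Longrightarrow> card S = 2 * n \<Longrightarrow> False"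
begin

lemma finite_sub: "S \<subseteq> V \<Longrightarrow> finite S"
  using finite_V finite_subset by blast

lemma no_large_matchable:
  assumes "v \<in> V" "v \<notin> S" "S \<subseteq> V" "S \<inter> nb v = {}" "matchable nonadj S"
  shows "card S < 2 * n"
proof (rule ccontr)
  assume "\<not> card S < 2 * n"
  then obtain T where "T \<subseteq> S" "matchable nonadj T" "card T = 2 * n"
    using matchable_subset_card[of S nonadj n] assms finite_sub by auto
  then show False using no_fan[of v T] assms by blast
qed

text \<open>
  Attaching vertices to the edges of a triangle is choosing distinct representatives. If one
  edge has a further common neighbour and the other two have codegrees at least three and
  four, then the choice can be made greedily, starting with the scarcest edge.
\<close>

lemma no_hajos_codegree:
  assumes "adj a b" "adj b c" "adj c a" "card (nb a \<inter> nb b) \<ge> 4" "card (nb b \<inter> nb c) \<ge> 3"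
    and "adj z c" "adj z a" "z \<noteq> b"
  shows False
proof -
  have "card {a, z} < card (nb b \<inter> nb c)"
    using assms(5) by (simp add: card_insert_if)
  then obtain y where y: "y \<in> nb b \<inter> nb c" "y \<notin> {a, z}"
    by (rule obtain_outside[rotated]) auto
  have "card {c, y, z} \<le> 3" by (simp add: card_insert_if)
  then obtain x where x: "x \<in> nb a \<inter> nb b" "x \<notin> {c, y, z}"
    using obtain_outside[of "{c, y, z}" "nb a \<inter> nb b"] assms(4) by auto
  show False
    by (rule no_hajos[of a b c x y z]) (use assms x y adj_sym in auto)
qed

lemma no_triple_codegree:
  assumes "adj a b" "adj b c" "adj c a" "card (nb a \<inter> nb b \<inter> nb c) \<ge> 3"
  shows False
proof -
  obtain x y z where "x \<in> nb a \<inter> nb b \<inter> nb c" "y \<in> nb a \<inter> nb b \<inter> nb c" "z \<in> nb a \<inter> nb b \<inter> nb c"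
    "x \<noteq> y" "y \<noteq> z" "x \<noteq> z" using obtain_three[OF assms(4)] .
  then show False
    by (intro no_hajos[of a b c x y z]) (use assms adj_sym adj_irrefl in auto)
qed

definition nonnb :: "'a \<Rightarrow> 'a set" where
  "nonnb v = V - insert v (nb v)"

lemma card_nonnb:
  assumes "v \<in> V"
  shows "card (nonnb v) + card (nb v) = 4 * n + 1"
proof -
  have "insert v (nb v) \<subseteq> V" "v \<notin> nb v"
    using assms nb_subset adj_irrefl by auto
  then have "card (nonnb v) = card V - (card (nb v) + 1)" "card (nb v) + 1 \<le> card V"
    unfolding nonnb_def using card_mono[OF finite_V, of "insert v (nb v)"]
    by (auto simp: card_Diff_subset)
  then show ?thesis using card_V by simp
qed

text \<open>
  A maximum matching among the non-neighbours of \<open>v\<close> has fewer than \<open>n\<close> pairs, and the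
  vertices that it misses form a clique of the graph.
\<close>

lemma nonnb_maximum_pairing:
  assumes v: "v \<in> V"
  obtains T \<sigma> where "T \<subseteq> nonnb v" "pairing nonadj \<sigma> T" "card T + 2 \<le> 2 * n"
    and "\<And>u v'. u \<in> nonnb v - T \<Longrightarrow> v' \<in> nonnb v - T \<Longrightarrow> u \<noteq> v' \<Longrightarrow> adj u v'"
    and "\<And>u v' w. u \<in> nonnb v - T \<Longrightarrow> v' \<in> nonnb v - T \<Longrightarrow> u \<noteq> v' \<Longrightarrow> w \<in> T \<Longrightarrow>
      adj u w \<or> adj v' (\<sigma> w)"
proof -
  define S where "S = nonnb v"
  have S: "S \<subseteq> V" "v \<notin> S" "S \<inter> nb v = {}" and finS: "finite S"
    using finite_V by (auto simp: S_def nonnb_def)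
  obtain T \<sigma> where T: "T \<subseteq> S" "pairing nonadj \<sigma> T"
    and un: "\<And>u v. u \<in> S - T \<Longrightarrow> v \<in> S - T \<Longrightarrow> u \<noteq> v \<Longrightarrow> \<not> nonadj u v"
    and ex: "\<And>u v w. u \<in> S - T \<Longrightarrow> v \<in> S - T \<Longrightarrow> u \<noteq> v \<Longrightarrow> w \<in> T \<Longrightarrow> nonadj u w \<Longrightarrow> \<not> nonadj v (\<sigma> w)"
    by (rule maximum_pairing[of S nonadj]) (use finS adj_sym in auto)
  have finT: "finite T" using T(1) finS finite_subset by blast
  have mT: "matchable nonadj T" using T(2) by (auto simp: matchable_def)
  have "card T < 2 * n" by (rule no_large_matchable[OF v]) (use T S mT in auto)
  then have "card T + 2 \<le> 2 * n" using matchable_even[OF finT mT] by (auto elim!: evenE)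
  then show thesis using that[of T \<sigma>] T un ex unfolding S_def by blast
qed

text \<open>
  A smaller degree leaves at least four non-neighbours \<open>U\<close> unmatched, and \<open>U\<close> is a clique. By
  maximality each matched pair has an end adjacent to all but at most one vertex of \<open>U\<close>. Among
  nine such ends, three are adjacent to the same three vertices of \<open>U\<close>, which form a triangle
  with three common neighbours. With fewer than nine such ends, the unmatched clique has six
  vertices. Both give a Hajos graph.
\<close>

lemma degree_ge:
  assumes v: "v \<in> V"
  shows "card (nb v) \<ge> 2 * n"
proof (rule ccontr)
  assume small: "\<not> card (nb v) \<ge> 2 * n"
  define S where "S = nonnb v"
  have finS: "finite S" using finite_V by (simp add: S_def nonnb_def)
  have cS: "card S \<ge> 2 * n + 2"
    using small card_nonnb[OF v] by (simp add: S_def)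
  obtain T \<sigma> where T: "T \<subseteq> S" "pairing nonadj \<sigma> T" and cT: "card T + 2 \<le> 2 * n"
    and un: "\<And>u v. u \<in> S - T \<Longrightarrow> v \<in> S - T \<Longrightarrow> u \<noteq> v \<Longrightarrow> adj u v"
    and ex: "\<And>u v w. u \<in> S - T \<Longrightarrow> v \<in> S - T \<Longrightarrow> u \<noteq> v \<Longrightarrow> w \<in> T \<Longrightarrow> adj u w \<or> adj v (\<sigma> w)"
    unfolding S_def using nonnb_maximum_pairing[OF v] by blast
  have finT: "finite T" using T(1) finS finite_subset by blast
  have cST: "card (S - T) = card S - card T"
    using T(1) finT by (simp add: card_Diff_subset)
  then have "card (S - T) \<ge> 4" using cS cT by simp
  then obtain U where U: "U \<subseteq> S - T" "card U = 4"
    by (rule obtain_subset_with_card_n) blast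
  have finU: "finite U" using U(2) card.infinite by fastforce
  define K where "K = {w \<in> T. card (U - nb w) \<le> 1}"
  have finK: "finite K" using finT by (simp add: K_def)
  have "\<sigma> w \<in> K" if w: "w \<in> T - K" for w
  proof (rule ccontr)
    assume no: "\<sigma> w \<notin> K"
    have sw: "\<sigma> w \<in> T" using w T(2) by (auto simp: pairing_def)
    have "card (U - nb w) \<ge> 2" "card (U - nb (\<sigma> w)) \<ge> 2"
      using w sw no by (auto simp: K_def)
    then obtain u u' where u: "u \<in> U - nb w" "u' \<in> U - nb w" "u \<noteq> u'"
      by (elim obtain_two)
    have "\<not> U - nb (\<sigma> w) \<subseteq> {u}"
      using \<open>card (U - nb (\<sigma> w)) \<ge> 2\<close> card_mono[of "{u}" "U - nb (\<sigma> w)"] by (intro notI) simp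
    then obtain p where p: "p \<in> U - nb (\<sigma> w)" "p \<noteq> u" by blast
    then show False
      using ex[of u p w] u U(1) w adj_sym by auto
  qed
  moreover have "inj_on \<sigma> T"
    using T(2) unfolding pairing_def inj_on_def by metis
  ultimately have "card (T - K) \<le> card K"
    using finK by (intro card_inj_on_le[of \<sigma>]) (auto intro: inj_on_subset)
  moreover have "card (T - K) = card T - card K"
    using finK by (intro card_Diff_subset) (auto simp: K_def)
  ultimately have TK: "card T \<le> 2 * card K" by simp
  show False
  proof (cases "card K \<ge> 9")
    case True
    have "\<exists>u\<in>U. U - {u} \<subseteq> nb w" if "w \<in> K" for w
    proof (cases "U - nb w = {}")
      case True
      then show ?thesis using U(2) by (cases "U = {}") auto
    next
      case False
      have "card (U - nb w) = 1" using that False finU by (auto simp: K_def le_Suc_eq)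
      then show ?thesis by (metis Diff_iff One_nat_def card_1_singletonE insertI1 subsetI)
    qed
    then obtain g where g: "\<And>w. w \<in> K \<Longrightarrow> g w \<in> U \<and> U - {g w} \<subseteq> nb w" by metis
    \<comment> \<open>Nine vertices in four classes, one for each \<open>u\<close>: some class has three.\<close>
    have "\<exists>u\<in>U. card {w \<in> K. g w = u} \<ge> 3"
    proof (rule ccontr)
      assume "\<not> ?thesis"
      then have le: "card {w \<in> K. g w = u} \<le> 2" if "u \<in> U" for u
        using that by force
      have "K = (\<Union>u\<in>U. {w \<in> K. g w = u})" using g by auto
      then have "card K \<le> (\<Sum>u\<in>U. card {w \<in> K. g w = u})"
        using card_UN_le[OF finU, of "\<lambda>u. {w \<in> K. g w = u}"] by simp
      also have "\<dots> \<le> card U * 2"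
        using sum_bounded_above[of U "\<lambda>u. card {w \<in> K. g w = u}" 2] le by simp
      finally show False using True U(2) by simp
    qed
    then obtain u where u: "u \<in> U" "card {w \<in> K. g w = u} \<ge> 3" by blast
    have "card (U - {u}) \<ge> 3" using u U(2) by simp
    then obtain a b c where abc: "a \<in> U - {u}" "b \<in> U - {u}" "c \<in> U - {u}" "a \<noteq> b" "b \<noteq> c" "a \<noteq> c"
      by (rule obtain_three)
    have adjs: "adj a b" "adj b c" "adj c a" using un abc U(1) by blast+
    have "{w \<in> K. g w = u} \<subseteq> nb a \<inter> nb b \<inter> nb c"
      using g abc adj_sym by fastforce
    then have "card {w \<in> K. g w = u} \<le> card (nb a \<inter> nb b \<inter> nb c)"
      by (intro card_mono) auto
    then show False using no_triple_codegree[OF adjs] u(2) by simp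
  next
    case False
    then have six: "card (S - T) \<ge> 6" using TK cST cS n_ge by simp
    then have "card (S - T) \<ge> 3" by simp
    then obtain a b c where abc: "a \<in> S - T" "b \<in> S - T" "c \<in> S - T" "a \<noteq> b" "b \<noteq> c" "a \<noteq> c"
      by (rule obtain_three)
    have adjs: "adj a b" "adj b c" "adj c a" using un abc by blast+
    have "card (S - T - {a, b, c}) \<ge> 3"
      using six abc finS by (subst card_Diff_subset) auto
    moreover have "S - T - {a, b, c} \<subseteq> nb a \<inter> nb b \<inter> nb c"
      using un abc by fastforce
    then have "card (S - T - {a, b, c}) \<le> card (nb a \<inter> nb b \<inter> nb c)"
      by (intro card_mono) auto
    ultimately show False using no_triple_codegree[OF adjs] by simp
  qed
qed

lemma independent_matchable:
  assumes "finite S" "even (card S)" "\<And>u v. u \<in> S \<Longrightarrow> v \<in> S \<Longrightarrow> \<not> adj u v"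
  shows "matchable nonadj S"
proof (cases "S = {}")
  case False
  then have "card S \<ge> 2" using assms(1,2) by (metis card_gt_0_iff even_iff_mod_2_eq_zero dvd_imp_le)
  moreover have "S - nb v = S" if "v \<in> S" for v using assms(3) that by auto
  ultimately show ?thesis
    using assms by (intro star_forest_matchable) (auto simp: star_forest_def)
qed simp

text \<open>
  Without triangles neighbourhoods are independent, so degrees are at most \<open>2n\<close>; then each
  vertex has at least \<open>2n + 1\<close> non-neighbours, of which a maximum matching misses at least
  three, and any three of these form a triangle.
\<close>

lemma triangle_exists: "\<exists>a b c. adj a b \<and> adj b c \<and> adj c a"
proof (rule ccontr)
  assume free: "\<nexists>a b c. adj a b \<and> adj b c \<and> adj c a"
  have "V \<noteq> {}" using card_V by auto
  then obtain v where v: "v \<in> V" by auto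
  have ind: "\<not> adj x y" if "x \<in> nb u" "y \<in> nb u" for x y u
    using free that adj_sym by (metis nb_iff)
  have cap: "card (nb u) \<le> 2 * n" if u: "u \<in> V" for u
  proof (rule ccontr)
    assume "\<not> ?thesis"
    then have "card (nb u) \<ge> 2 * n + 1" by simp
    then obtain Q where Q: "Q \<subseteq> nb u" "card Q = 2 * n + 1"
      by (rule obtain_subset_with_card_n) blast
    then obtain s where s: "s \<in> Q" by (metis Suc_eq_plus1 card_eq_SucD insertI1)
    have "finite Q" using Q nb_subset finite_sub by blast
    have "matchable nonadj (Q - {s})"
    proof (rule independent_matchable)
      show "\<not> adj x y" if "x \<in> Q - {s}" "y \<in> Q - {s}" for x y
        using ind[of x u y] that Q(1) by blast
    qed (use \<open>finite Q\<close> s Q in auto)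
    moreover have "card (Q - {s}) = 2 * n" using s Q \<open>finite Q\<close> by simp
    moreover have "s \<in> V" "Q - {s} \<subseteq> V" using s Q(1) nb_subset by blast+
    moreover have "(Q - {s}) \<inter> nb s = {}" using ind s Q(1) by (meson disjoint_iff nb_iff subsetD Diff_subset)
    ultimately show False using no_fan[of s "Q - {s}"] by simp
  qed
  define S where "S = nonnb v"
  have "card S \<ge> 2 * n + 1"
    using cap[OF v] card_nonnb[OF v] by (simp add: S_def)
  obtain T where T: "T \<subseteq> S" "card T + 2 \<le> 2 * n"
    and un: "\<And>u v. u \<in> S - T \<Longrightarrow> v \<in> S - T \<Longrightarrow> u \<noteq> v \<Longrightarrow> adj u v"
    using nonnb_maximum_pairing[OF v, folded S_def] by metis
  have "finite T" using T(1) finite_V by (auto simp: S_def nonnb_def intro: finite_subset)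
  then have "card (S - T) \<ge> 3" using T \<open>card S \<ge> 2 * n + 1\<close> by (simp add: card_Diff_subset)
  then obtain a b c where "a \<in> S - T" "b \<in> S - T" "c \<in> S - T" "a \<noteq> b" "b \<noteq> c" "a \<noteq> c"
    by (rule obtain_three)
  then have "adj a b" "adj b c" "adj c a" using un by auto
  then show False using free by blast
qed

end

section \<open>Two large star forests\<close>

lemma card_Int_ge:
  assumes "finite W" "X \<subseteq> W" "Y \<subseteq> W"
  shows "card X + card Y \<le> card (X \<inter> Y) + card W"
proof -
  have "finite X" "finite Y" using assms finite_subset by blast+
  then have "card X + card Y = card (X \<union> Y) + card (X \<inter> Y)" by (rule card_Un_Int)
  moreover have "card (X \<union> Y) \<le> card W" using assms by (intro card_mono) auto
  ultimately show ?thesis by simp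
qed

context graph
begin

lemma star_forestI:
  assumes "\<And>a b c. a \<in> A \<Longrightarrow> b \<in> A \<Longrightarrow> c \<in> A \<Longrightarrow> adj a b \<Longrightarrow> adj b c \<Longrightarrow> adj c a \<Longrightarrow> False"
    and "\<And>a b c d. a \<in> A \<Longrightarrow> b \<in> A \<Longrightarrow> c \<in> A \<Longrightarrow> d \<in> A \<Longrightarrow> adj a b \<Longrightarrow> adj b c \<Longrightarrow> adj c d \<Longrightarrow>
      a \<noteq> c \<Longrightarrow> b \<noteq> d \<Longrightarrow> a \<noteq> d \<Longrightarrow> False"
  shows "star_forest A"
  unfolding star_forest_def
proof (intro ballI impI, rule ccontr)
  fix u v assume uv: "u \<in> A" "v \<in> A" "adj u v"
    and no: "\<not> (nb u \<inter> A = {v} \<or> nb v \<inter> A = {u})"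
  have "v \<in> nb u \<inter> A" "u \<in> nb v \<inter> A" using uv adj_sym by auto
  then obtain x w where "x \<in> nb u \<inter> A" "x \<noteq> v" "w \<in> nb v \<inter> A" "w \<noteq> u"
    using no by blast
  then have x: "adj u x" "x \<in> A" "x \<noteq> v" and w: "adj v w" "w \<in> A" "w \<noteq> u" by auto
  show False
  proof (cases "x = w")
    case True
    then show False using assms(1)[of u v x] uv x w adj_sym by blast
  next
    case False
    then show False using assms(2)[of x u v w] uv x w adj_sym by blast
  qed
qed

lemma card_nb_split: "card (nb v - A) + card (nb v \<inter> A) = card (nb v)"
  using card_Int_Diff[of "nb v" A] by simp

text \<open>
  The vertices of a star forest that are not centres of stars with at least two leaves.
\<close>

definition low :: "'a set \<Rightarrow> 'a set" where
  "low A = {a \<in> A. card (nb a \<inter> A) \<le> 1}"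

lemma star_forest_leaf:
  assumes "star_forest A" "u \<in> A" "v \<in> A" "adj u v" "card (nb v \<inter> A) \<ge> 2"
  shows "nb u \<inter> A = {v}"
proof -
  have "nb u \<inter> A = {v} \<or> nb v \<inter> A = {u}"
    using assms(1-4) unfolding star_forest_def by blast
  moreover have "nb v \<inter> A \<noteq> {u}" using assms(5) by auto
  ultimately show ?thesis by blast
qed

lemma star_forest_leaf_low:
  assumes "star_forest A" "u \<in> A" "v \<in> A" "adj u v" "card (nb v \<inter> A) \<ge> 2"
  shows "u \<in> low A"
  using star_forest_leaf[OF assms] assms(2) by (simp add: low_def)

lemma star_forest_two_low:
  assumes "star_forest A" "card A \<ge> 2"
  obtains u v where "u \<in> low A" "v \<in> low A" "u \<noteq> v"
proof (cases "A \<subseteq> low A")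
  case True
  then show thesis using assms(2) obtain_two[of A] that by blast
next
  case False
  then obtain v where v: "v \<in> A" "card (nb v \<inter> A) \<ge> 2" by (force simp: low_def)
  then obtain x y where "x \<in> nb v \<inter> A" "y \<in> nb v \<inter> A" "x \<noteq> y" by (elim obtain_two)
  then show thesis
    using that[of x y] star_forest_leaf_low[OF assms(1) _ v(1) _ v(2)] adj_sym by auto
qed

end

context critical_graph
begin

lemma card_Diff_V:
  assumes "A \<subseteq> V"
  shows "card (V - A) + card A = 4 * n + 2"
  using assms finite_sub[OF assms] card_mono[OF finite_V assms] by (simp add: card_Diff_subset card_V)

text \<open>
  A path \<open>a, b, c, d\<close> inside the common neighbourhood of \<open>y\<close> and \<open>y'\<close> gives a Hajos graph: the
  triangle is \<open>y, b, c\<close>, and \<open>a\<close>, \<open>y'\<close>, \<open>d\<close> are attached to its edges. Hence a triangle inside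
  \<open>A\<close> would be a component of \<open>A\<close>, and the neighbourhoods of its vertices outside \<open>A\<close> would
  overlap heavily.
\<close>

lemma common_neighbourhood_star_forest:
  assumes A: "A \<subseteq> nb y \<inter> nb y'" "y \<noteq> y'" and large: "card A \<ge> 2 * n - 10"
  shows "star_forest A"
proof -
  have path: False
    if "a \<in> A" "b \<in> A" "c \<in> A" "d \<in> A" "adj a b" "adj b c" "adj c d" "a \<noteq> c" "b \<noteq> d" "a \<noteq> d" for a b c d
  proof -
    have *: "adj y v" "adj y' v" "adj v y" "adj v y'" "v \<noteq> y" "v \<noteq> y'" if "v \<in> A" for v
      using that A(1) adj_sym adj_irrefl by auto
    show False
      using no_hajos[of y b c a y' d] *[OF that(1)] *[OF that(2)] *[OF that(3)] *[OF that(4)] that(5-) A(2)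
        adj_sym[OF that(7)] by simp
  qed
  have AV: "A \<subseteq> V" using A(1) nb_subset by blast
  show ?thesis
  proof (rule star_forestI)
    fix a b c assume abc: "a \<in> A" "b \<in> A" "c \<in> A" and adjs: "adj a b" "adj b c" "adj c a"
    have outer: "card (nb u - A) \<ge> 2 * n - 2"
      if u: "u \<in> A" "v \<in> A" "w \<in> A" "adj u v" "adj v w" "adj w u" for u v w
    proof -
      have "nb u \<inter> A \<subseteq> {v, w}"
      proof
        fix x assume "x \<in> nb u \<inter> A"
        then show "x \<in> {v, w}"
          using path[of x u v w] u adj_sym adj_irrefl by auto
      qed
      then have "card (nb u \<inter> A) \<le> card {v, w}" by (intro card_mono) auto
      also have "\<dots> \<le> 2" by (simp add: card_insert_if)
      finally show ?thesis using card_nb_split[of u A] degree_ge[of u] u AV by auto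
    qed
    have codeg: "card (nb u \<inter> nb v) \<ge> 4"
      if u: "card (nb u - A) \<ge> 2 * n - 2" "card (nb v - A) \<ge> 2 * n - 2" for u v
    proof -
      have "card (nb u - A) + card (nb v - A) \<le> card ((nb u - A) \<inter> (nb v - A)) + card (V - A)"
        using finite_V nb_subset by (intro card_Int_ge) auto
      moreover have "card ((nb u - A) \<inter> (nb v - A)) \<le> card (nb u \<inter> nb v)"
        by (intro card_mono) auto
      ultimately show ?thesis using u card_Diff_V[OF AV] large n_ge by linarith
    qed
    have oa: "card (nb a - A) \<ge> 2 * n - 2" "card (nb b - A) \<ge> 2 * n - 2" "card (nb c - A) \<ge> 2 * n - 2"
      using outer[of a b c] outer[of b c a] outer[of c a b] abc adjs by blast+
    have "card (nb a \<inter> nb c) \<ge> 4" by (rule codeg[OF oa(1,3)])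
    then obtain z where "z \<in> nb a \<inter> nb c" "z \<notin> {b}"
      using obtain_outside[of "{b}" "nb a \<inter> nb c"] by auto
    then show False
      using no_hajos_codegree[OF adjs codeg[OF oa(1,2)], of z] codeg[OF oa(2,3)] adj_sym by auto
  qed (rule path)
qed

text \<open>
  Otherwise the three neighbourhoods of a triangle, each of size at least \<open>2n\<close>, overlap too
  little to fit into the vertex set.
\<close>

lemma codegree_four_edge: "\<exists>p q. adj p q \<and> card (nb p \<inter> nb q) \<ge> 4"
proof (rule ccontr)
  assume "\<not> ?thesis"
  then have le: "card (nb p \<inter> nb q) \<le> 3" if "adj p q" for p q
    using that by (metis not_less_eq_eq numeral_eq_Suc pred_numeral_simps(2) semiring_norm(26,27))
  obtain a b c where abc: "adj a b" "adj b c" "adj c a"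
    using triangle_exists by blast
  have deg: "card (nb a) \<ge> 2 * n" "card (nb b) \<ge> 2 * n" "card (nb c) \<ge> 2 * n"
    using abc adj_in_V degree_ge by blast+
  have "card (nb a) + card (nb b) = card (nb a \<union> nb b) + card (nb a \<inter> nb b)"
    by (rule card_Un_Int) auto
  moreover have "card (nb a \<union> nb b) + card (nb c) = card (nb a \<union> nb b \<union> nb c) + card ((nb a \<union> nb b) \<inter> nb c)"
    by (rule card_Un_Int) auto
  moreover have "card ((nb a \<union> nb b) \<inter> nb c) \<le> card (nb a \<inter> nb c) + card (nb b \<inter> nb c)"
    by (metis Int_Un_distrib2 card_Un_le)
  moreover have "card (nb a \<union> nb b \<union> nb c) \<le> card V"
    using finite_V nb_subset by (intro card_mono) auto
  ultimately show False
    using deg le[of a b] le[of b c] le[of a c] abc adj_sym n_ge card_V by fastforce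
qed

text \<open>
  Each page \<open>y\<close> of a book with spine \<open>p, q\<close> forms a triangle with the spine, and the spine has
  common neighbours to spare; so the other two edges of the triangle cannot both have codegree
  three or more.
\<close>

lemma page_codegree:
  assumes "adj p q" "card (nb p \<inter> nb q) \<ge> 4" "y \<in> nb p \<inter> nb q"
  shows "card (nb p \<inter> nb y) \<le> 2 \<or> card (nb q \<inter> nb y) \<le> 2"
proof (rule ccontr)
  assume no: "\<not> ?thesis"
  then obtain z where "z \<in> nb p \<inter> nb y" "z \<notin> {q}"
    using obtain_outside[of "{q}" "nb p \<inter> nb y"] by auto
  then show False
    using no_hajos_codegree[of p q y z] assms no adj_sym by auto
qed

text \<open>
  Among three pages of a book, two have small codegree with the same end \<open>p\<close> of the spine.
  Their neighbourhoods lie almost entirely outside the neighbourhood of \<open>p\<close>, a set of at most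
  \<open>2n + 2\<close> vertices, and so they almost coincide.
\<close>

lemma first_half: "\<exists>A\<subseteq>V. card A = 2 * n - 6 \<and> star_forest A"
proof -
  have two: ?thesis
    if p: "adj p y" "adj p y'" "y \<noteq> y'" "card (nb p \<inter> nb y) \<le> 2" "card (nb p \<inter> nb y') \<le> 2" for p y y'
  proof -
    let ?W = "V - nb p"
    have V: "p \<in> V" "y \<in> V" "y' \<in> V" using p adj_in_V adj_sym by blast+
    have sp: "card (nb y - nb p) + card (nb p \<inter> nb y) = card (nb y)"
      "card (nb y' - nb p) + card (nb p \<inter> nb y') = card (nb y')"
      using card_nb_split[of y "nb p"] card_nb_split[of y' "nb p"] by (simp_all add: Int_commute)
    have "card (nb y - nb p) + card (nb y' - nb p) \<le> card ((nb y - nb p) \<inter> (nb y' - nb p)) + card ?W"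
      using finite_V nb_subset by (intro card_Int_ge) auto
    then have "card ((nb y - nb p) \<inter> (nb y' - nb p)) \<ge> 2 * n - 6"
      using sp p degree_ge[OF V(1)] degree_ge[OF V(2)] degree_ge[OF V(3)] card_Diff_V[OF nb_subset, of p] by linarith
    then obtain A where A: "A \<subseteq> (nb y - nb p) \<inter> (nb y' - nb p)" "card A = 2 * n - 6"
      by (rule obtain_subset_with_card_n) blast
    then have "star_forest A"
      using p by (intro common_neighbourhood_star_forest[of A y y']) auto
    then show ?thesis using A nb_subset by blast
  qed
  obtain p q where pq: "adj p q" "card (nb p \<inter> nb q) \<ge> 4"
    using codegree_four_edge by blast
  then have "card (nb p \<inter> nb q) \<ge> 3" by simp
  then obtain x y z where xyz: "x \<in> nb p \<inter> nb q" "y \<in> nb p \<inter> nb q" "z \<in> nb p \<inter> nb q"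
    "x \<noteq> y" "y \<noteq> z" "x \<noteq> z" by (rule obtain_three)
  then have adjs: "adj p x" "adj p y" "adj p z" "adj q x" "adj q y" "adj q z" by auto
  let ?P = "\<lambda>r w. card (nb r \<inter> nb w) \<le> 2"
  have "?P p x \<and> ?P p y \<or> ?P p x \<and> ?P p z \<or> ?P p y \<and> ?P p z \<or>
      ?P q x \<and> ?P q y \<or> ?P q x \<and> ?P q z \<or> ?P q y \<and> ?P q z"
    using page_codegree[OF pq xyz(1)] page_codegree[OF pq xyz(2)] page_codegree[OF pq xyz(3)] by argo
  then show ?thesis
    using two[OF adjs(1,2) xyz(4)] two[OF adjs(1,3) xyz(6)] two[OF adjs(2,3) xyz(5)]
      two[OF adjs(4,5) xyz(4)] two[OF adjs(4,6) xyz(6)] two[OF adjs(5,6) xyz(5)] by argo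
qed

text \<open>
  An approximate bipartition of the graph into two sparse parts; only 18 vertices are left
  out. The asymmetric sizes come from the construction: two low vertices of \<open>A\<close> have at least
  \<open>2n - 10\<close> common neighbours outside \<open>A\<close>.
\<close>

definition core :: "'a set \<Rightarrow> 'a set \<Rightarrow> bool" where
  "core A B \<longleftrightarrow> A \<subseteq> V \<and> B \<subseteq> V \<and> A \<inter> B = {} \<and> star_forest A \<and> star_forest B \<and>
     card A = 2 * n - 6 \<and> card B = 2 * n - 10"

lemma core_exists: "\<exists>A B. core A B"
proof -
  obtain A where A: "A \<subseteq> V" "card A = 2 * n - 6" "star_forest A"
    using first_half by blast
  obtain u v where uv: "u \<in> low A" "v \<in> low A" "u \<noteq> v"
  proof (rule star_forest_two_low[OF A(3)])
    show "2 \<le> card A" using A(2) n_ge by simp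
  qed
  have "card (nb u - A) + card (nb v - A) \<le> card ((nb u - A) \<inter> (nb v - A)) + card (V - A)"
    using finite_V nb_subset by (intro card_Int_ge) auto
  moreover have "u \<in> V" "v \<in> V" "card (nb u \<inter> A) \<le> 1" "card (nb v \<inter> A) \<le> 1"
    using uv A(1) by (auto simp: low_def)
  ultimately have "card ((nb u - A) \<inter> (nb v - A)) \<ge> 2 * n - 10"
    using card_nb_split[of u A] card_nb_split[of v A] card_Diff_V[OF A(1)] A(2)
      degree_ge[of u] degree_ge[of v] n_ge by linarith
  then obtain B where B: "B \<subseteq> (nb u - A) \<inter> (nb v - A)" "card B = 2 * n - 10"
    by (rule obtain_subset_with_card_n) blast
  then have "star_forest B"
    using uv(3) by (intro common_neighbourhood_star_forest[of B u v]) auto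
  moreover have "B \<subseteq> V" "A \<inter> B = {}"
    using B(1) nb_subset by auto
  ultimately have "core A B"
    unfolding core_def using A B(2) by simp
  then show ?thesis by blast
qed

end

context graph
begin

text \<open>
  Stars of a star forest are disjoint, so there are few large ones.
\<close>

lemma big_centres:
  assumes "star_forest A" "finite A" "M \<subseteq> A" "\<And>c. c \<in> M \<Longrightarrow> k \<le> card (nb c \<inter> A)" "k \<ge> 2"
  shows "card M * k \<le> card A"
proof -
  have finM: "finite M" using assms(2,3) finite_subset by blast
  have dis: "(nb c \<inter> A) \<inter> (nb c' \<inter> A) = {}" if c: "c \<in> M" "c' \<in> M" "c \<noteq> c'" for c c'
  proof (rule ccontr)
    assume "\<not> ?thesis"
    then obtain l where l: "l \<in> A" "adj l c" "adj l c'" by (meson Int_iff adj_sym disjoint_iff nb_iff)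
    have big: "card (nb c \<inter> A) \<ge> 2" "card (nb c' \<inter> A) \<ge> 2" "c \<in> A" "c' \<in> A"
      using assms(3-5) c order_trans by blast+
    have "nb l \<inter> A = {c}" by (rule star_forest_leaf) (use assms(1) l big in auto)
    moreover have "nb l \<inter> A = {c'}" by (rule star_forest_leaf) (use assms(1) l big in auto)
    ultimately show False using c(3) by auto
  qed
  have "card M * k = (\<Sum>c\<in>M. k)" by simp
  also have "\<dots> \<le> (\<Sum>c\<in>M. card (nb c \<inter> A))" by (intro sum_mono assms(4))
  also have "\<dots> = card (\<Union>c\<in>M. nb c \<inter> A)"
    by (rule card_UN_disjoint[symmetric]) (use finM dis in auto)
  also have "\<dots> \<le> card A" using assms(2) by (intro card_mono) auto
  finally show ?thesis .
qed

lemma big_centres_less: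
  assumes "star_forest A" "finite A" "M \<subseteq> A" "\<And>c. c \<in> M \<Longrightarrow> k \<le> card (nb c \<inter> A)" "k \<ge> 2"
    and "card A < m * k"
  shows "card M < m"
proof (rule ccontr)
  assume "\<not> card M < m"
  then have "m * k \<le> card M * k" by simp
  also have "\<dots> \<le> card A" by (rule big_centres[OF assms(1-5)])
  finally show False using assms(6) by simp
qed

end

context critical_graph
begin

text \<open>
  The common properties of the two parts of a core, for the lemmas that apply to either part.
\<close>

definition half :: "'a set \<Rightarrow> bool" where
  "half A \<longleftrightarrow> A \<subseteq> V \<and> star_forest A \<and> 2 * n \<le> card A + 10 \<and> card A + 6 \<le> 2 * n"

lemma nonneighbours_across:
  assumes "A \<subseteq> V" "B \<subseteq> V" "A \<inter> B = {}" "a \<in> A"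
  shows "card (B - nb a) + card A \<le> 2 * n + 2 + card (nb a \<inter> A)"
proof -
  have "card (B - nb a) \<le> card (V - A - (nb a - A))"
    using assms finite_V by (intro card_mono) auto
  also have "\<dots> = card (V - A) - card (nb a - A)"
    using nb_subset by (intro card_Diff_subset) auto
  finally have "card (B - nb a) \<le> card (V - A) - card (nb a - A)" .
  moreover have "card (nb a - A) \<le> card (V - A)"
    using finite_V nb_subset by (intro card_mono) auto
  ultimately show ?thesis
    using card_nb_split[of a A] card_Diff_V[OF assms(1)] degree_ge[of a] assms(1,4) by auto
qed

text \<open>
  This is how fans are found. The set consists of non-neighbours of \<open>a\<close>, and it contains all
  but three vertices of \<open>A\<close>: only \<open>a\<close>, its neighbour in \<open>A\<close> and the centre of one dominating
  star can be missing. If it had \<open>2n\<close> vertices, then \<open>2n\<close> of them could be chosen as a star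
  forest \<open>C \<subseteq> A\<close> and at most \<open>2n + 3 - card A\<close> further vertices, each with enough
  non-neighbours in \<open>C\<close> to be matched. The threshold \<open>2n + 8 - card A\<close> on the number of
  non-neighbours in \<open>A\<close> is what \<open>star_forest_plus_matchable\<close> asks for after losing three
  vertices of \<open>A\<close>.
\<close>

lemma few_obstructed_nonneighbours:
  assumes half: "half A" and a: "a \<in> low A"
  shows "card {v \<in> V. v \<noteq> a \<and> \<not> adj a v \<and> 2 * n + 8 \<le> card A + card (A - nb v)} < 2 * n"
    (is "card ?M < _")
proof (rule ccontr)
  assume large: "\<not> card ?M < 2 * n"
  have A: "A \<subseteq> V" "star_forest A" "2 * n \<le> card A + 10" "card A + 6 \<le> 2 * n" "finite A"
    using half finite_sub by (auto simp: half_def)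
  have aA: "a \<in> A" "card (nb a \<inter> A) \<le> 1" using a by (auto simp: low_def)
  have finM: "finite ?M" using finite_V by simp
  define C where "C = ?M \<inter> A"
  define X where "X = {v \<in> A. card A + card (A - nb v) < 2 * n + 8}"
  have "card X < 2"
  proof (rule big_centres_less[OF A(2,5)])
    fix c assume "c \<in> X"
    then have "card A + card (A - nb c) < 2 * n + 8" by (simp add: X_def)
    moreover have "card A = card (nb c \<inter> A) + card (A - nb c)"
      using card_Int_Diff[OF A(5), of "nb c"] by (simp add: Int_commute)
    ultimately show "2 * card A - 2 * n - 7 \<le> card (nb c \<inter> A)" by linarith
  qed (use A n_ge in \<open>auto simp: X_def\<close>)
  moreover have "A - C \<subseteq> insert a ((nb a \<inter> A) \<union> X)"
    using A(1) by (auto simp: C_def X_def)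
  then have "card (A - C) \<le> card (insert a ((nb a \<inter> A) \<union> X))"
    using A(5) by (intro card_mono) (auto simp: X_def)
  moreover have "card (insert a ((nb a \<inter> A) \<union> X)) \<le> 1 + card ((nb a \<inter> A) \<union> X)"
    using A(5) by (simp add: card_insert_if X_def)
  moreover have "card ((nb a \<inter> A) \<union> X) \<le> card (nb a \<inter> A) + card X" by (rule card_Un_le)
  ultimately have AC: "card (A - C) \<le> 3" using aA by linarith
  have CA: "C \<subseteq> A" "C \<subseteq> ?M" "finite C" using A(5) by (auto simp: C_def)
  have cC: "card C + card (A - C) = card A"
    using CA A(5) card_mono[OF A(5) CA(1)] by (simp add: card_Diff_subset)
  have "card (?M - C) = card ?M - card C" using CA finM by (intro card_Diff_subset) auto
  then have "2 * n - card C \<le> card (?M - C)" using large by simp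
  then obtain E where E: "E \<subseteq> ?M - C" "card E = 2 * n - card C"
    by (rule obtain_subset_with_card_n) blast
  have finE: "finite E" using E(1) finM finite_subset by blast
  have card_S: "card (C \<union> E) = 2 * n"
    using E cC A(4) CA(3) finE by (subst card_Un_disjoint) auto
  have "matchable nonadj (C \<union> E)"
  proof (rule star_forest_plus_matchable[OF finE CA(3)])
    show "star_forest C" using A(2) CA(1) by (rule star_forest_subset)
    show "C \<inter> E = {}" using E(1) by auto
    show "even (card (C \<union> E))" using card_S by simp
    fix v assume "v \<in> C \<union> E"
    then have "v \<in> ?M" using CA(2) E(1) by auto
    then have v: "2 * n + 8 \<le> card A + card (A - nb v)" by simp
    have "card (A - nb v) \<le> card ((C - nb v) \<union> (A - C))"
      using A(5) CA by (intro card_mono) auto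
    also have "\<dots> \<le> card (C - nb v) + card (A - C)" by (rule card_Un_le)
    finally show "card E + 2 \<le> card (C - nb v)"
      using v AC cC E(2) A(3,4) by linarith
  qed
  moreover have "C \<union> E \<subseteq> ?M" using CA(2) E(1) by blast
  then have "a \<notin> C \<union> E" "C \<union> E \<subseteq> V" "(C \<union> E) \<inter> nb a = {}" by auto
  ultimately show False
    using no_fan[of a "C \<union> E"] card_S aA A(1) by blast
qed

text \<open>
  If the edges of the triangle \<open>z, a, b\<close> at \<open>z\<close> have large codegree, then nothing else can be
  attached to \<open>a, b\<close>.
\<close>

lemma unique_common_neighbour:
  assumes "adj z a" "adj z b" "adj a b" "card (nb z \<inter> nb a) \<ge> 4" "card (nb z \<inter> nb b) \<ge> 4"
    and "adj w a" "adj w b"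
  shows "w = z"
proof (rule ccontr)
  assume "w \<noteq> z"
  then show False
    using no_hajos_codegree[of a z b w] assms adj_sym by (auto simp: Int_commute)
qed


section \<open>No vertex sees much of both parts\<close>

lemma coreD:
  assumes "core A B"
  shows "A \<subseteq> V" "B \<subseteq> V" "A \<inter> B = {}" "B \<inter> A = {}" "star_forest A" "star_forest B"
    "card A + 6 = 2 * n" "card B + 10 = 2 * n" "finite A" "finite B" "half A" "half B"
  using assms finite_sub n_ge by (auto simp: core_def half_def)

text \<open>
  Suppose \<open>z\<close> has many neighbours in both parts. Let \<open>P\<close> and \<open>Q\<close> be those in \<open>A\<close> and \<open>B\<close> whose
  codegree with \<open>z\<close> is at least four. For adjacent \<open>a \<in> P\<close> and \<open>b \<in> Q\<close> the vertex \<open>z\<close> is the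
  only common neighbour, so each of the \<open>4n - 1\<close> vertices besides \<open>a\<close>, \<open>b\<close>, \<open>z\<close> is a
  non-neighbour of \<open>a\<close> or of \<open>b\<close>. One of the two then has \<open>2n\<close> of them, which contradicts
  \<open>few_obstructed_nonneighbours\<close> if each of these vertices misses enough of the part on whose
  side it is counted. That is the case: if a neighbour \<open>e \<noteq> z\<close> of \<open>b\<close> were adjacent to almost
  all of \<open>A\<close>, it would have a common neighbour \<open>a' \<in> P\<close> with \<open>b\<close>, and then \<open>a'\<close> and \<open>b\<close> would
  have the two common neighbours \<open>e\<close> and \<open>z\<close>.

  All counts are relative to \<open>f\<close>, which is about \<open>n / 2\<close>. At most seven vertices fail the
  codegree condition on either side, as they are centres of large stars. The vertices of \<open>P\<close>
  and \<open>Q\<close> that are not low are few for the same reason: a centre in \<open>P\<close> and its leaf have no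
  common neighbour in \<open>Q\<close>, so the centre misses much of \<open>B\<close> and must have many leaves, and
  likewise for \<open>Q\<close>. These are the counts that demand the largest \<open>n\<close>.
\<close>

lemma core_separates:
  assumes core: "core A B" and z: "z \<in> V" and f: "4 * f + 11 \<le> 2 * n" "2 * n < 4 * f + 15"
    and zA: "f \<le> card (nb z \<inter> A) + 7" and zB: "f \<le> card (nb z \<inter> B) + 11"
  shows False
proof -
  note c = coreD[OF core]
  have f52: "f \<ge> 52" using f n_ge by linarith
  have misA: "card (A - nb b) \<le> 12 + card (nb b \<inter> B)" if "b \<in> B" for b
    using nonneighbours_across[OF c(2,1,4) that] c(8) by linarith
  have misB: "card (B - nb a) \<le> 8 + card (nb a \<inter> A)" if "a \<in> A" for a
    using nonneighbours_across[OF c(1,2,3) that] c(7) by linarith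
  define P where "P = {a \<in> nb z \<inter> A. card (nb z \<inter> nb a) \<ge> 4}"
  define Q where "Q = {b \<in> nb z \<inter> B. card (nb z \<inter> nb b) \<ge> 4}"
  have PA: "P \<subseteq> A" "finite P" and QB: "Q \<subseteq> B" "finite Q"
    using c(9,10) by (auto simp: P_def Q_def)
  have through: "card (nb z \<inter> S) \<le> card (nb z \<inter> nb v) + card (S - nb v)" if "finite S" for v S
  proof -
    have "card (nb z \<inter> S) \<le> card ((nb z \<inter> nb v) \<union> (S - nb v))"
      using that by (intro card_mono) auto
    also have "\<dots> \<le> card (nb z \<inter> nb v) + card (S - nb v)" by (rule card_Un_le)
    finally show ?thesis .
  qed
  have "card (nb z \<inter> A - P) < 8"
  proof (rule big_centres_less[OF c(5,9)])
    fix a assume "a \<in> nb z \<inter> A - P"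
    then have "a \<in> A" "card (nb z \<inter> nb a) \<le> 3" by (auto simp: P_def)
    then show "f - 22 \<le> card (nb a \<inter> A)"
      using through[OF c(10), of a] misB[of a] zB by linarith
  qed (use f f52 c(7) in auto)
  moreover have "card (nb z \<inter> A) = card P + card (nb z \<inter> A - P)"
  proof -
    have "nb z \<inter> A \<inter> P = P" by (auto simp: P_def)
    then show ?thesis using card_Int_Diff[of "nb z \<inter> A" P] by simp
  qed
  ultimately have cP: "card P + 14 \<ge> f" using zA by linarith
  have "card (nb z \<inter> B - Q) < 8"
  proof (rule big_centres_less[OF c(6,10)])
    fix b assume "b \<in> nb z \<inter> B - Q"
    then have "b \<in> B" "card (nb z \<inter> nb b) \<le> 3" by (auto simp: Q_def)
    then show "f - 22 \<le> card (nb b \<inter> B)"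
      using through[OF c(9), of b] misA[of b] zA by linarith
  qed (use f f52 c(8) in auto)
  moreover have "card (nb z \<inter> B) = card Q + card (nb z \<inter> B - Q)"
  proof -
    have "nb z \<inter> B \<inter> Q = Q" by (auto simp: Q_def)
    then show ?thesis using card_Int_Diff[of "nb z \<inter> B" Q] by simp
  qed
  ultimately have cQ: "card Q + 18 \<ge> f" using zB by linarith
  have unique: "w = z" if "a \<in> P" "b \<in> Q" "adj a b" "adj w a" "adj w b" for a b w
    using unique_common_neighbour[of z a b w] that by (auto simp: P_def Q_def)
  have meetP: "\<exists>a\<in>P. adj u a \<and> adj v a" if h: "card (A - nb u) + card (A - nb v) < card P" for u v
  proof -
    obtain a where "a \<in> P" "a \<notin> A - nb u" "a \<notin> A - nb v"
      using ex_outside_two[OF finite_Diff[OF c(9)] finite_Diff[OF c(9)] h] by blast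
    then show ?thesis using PA by auto
  qed
  have meetQ: "\<exists>b\<in>Q. adj u b \<and> adj v b" if h: "card (B - nb u) + card (B - nb v) < card Q" for u v
  proof -
    obtain b where "b \<in> Q" "b \<notin> B - nb u" "b \<notin> B - nb v"
      using ex_outside_two[OF finite_Diff[OF c(10)] finite_Diff[OF c(10)] h] by blast
    then show ?thesis using QB by auto
  qed
  \<comment> \<open>A centre of at least two leaves has a leaf other than \<open>z\<close>.\<close>
  have leaf: "\<exists>l\<in>low S. adj l c \<and> l \<noteq> z"
    if S: "star_forest S" and cc: "c \<in> S" "c \<notin> low S" for S c
  proof -
    have two: "card (nb c \<inter> S) \<ge> 2" using cc by (simp add: low_def)
    then obtain l where l: "l \<in> nb c \<inter> S" "l \<notin> {z}"
      using obtain_outside[of "{z}" "nb c \<inter> S"] by auto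
    then have "l \<in> low S" using star_forest_leaf_low[OF S _ cc(1) _ two] adj_sym by auto
    then show ?thesis using l adj_sym by auto
  qed
  have "card (Q - low B) < 17"
  proof (rule big_centres_less[OF c(6,10)])
    fix b assume b: "b \<in> Q - low B"
    then obtain l where l: "l \<in> low B" "adj l b" "l \<noteq> z" using leaf[OF c(6), of b] QB by auto
    have "\<not> card (A - nb b) + card (A - nb l) < card P"
    proof
      assume "card (A - nb b) + card (A - nb l) < card P"
      then obtain a where "a \<in> P" "adj b a" "adj l a" using meetP by blast
      then show False using unique[of a b l] b l adj_sym by auto
    qed
    moreover have "card (A - nb l) \<le> 13" using misA[of l] l by (simp add: low_def)
    ultimately show "f - 39 \<le> card (nb b \<inter> B)"
      using misA[of b] b QB cP by auto
  qed (use f f52 c(8) n_ge QB in auto)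
  moreover have "card Q = card (Q \<inter> low B) + card (Q - low B)"
    using card_Int_Diff[OF QB(2)] .
  ultimately have cQlow: "card (Q \<inter> low B) > 9" using cQ f52 by linarith
  have "card (P - low A) < 13"
  proof (rule big_centres_less[OF c(5,9)])
    fix a assume a: "a \<in> P - low A"
    then obtain l where l: "l \<in> low A" "adj l a" "l \<noteq> z" using leaf[OF c(5), of a] PA by auto
    have "\<not> card (B - nb a) + card (B - nb l) < card Q"
    proof
      assume "card (B - nb a) + card (B - nb l) < card Q"
      then obtain b where "b \<in> Q" "adj a b" "adj l b" using meetQ by blast
      then show False using unique[of a b l] a l adj_sym by auto
    qed
    moreover have "card (B - nb l) \<le> 9" using misB[of l] l by (simp add: low_def)
    ultimately show "f - 35 \<le> card (nb a \<inter> A)"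
      using misB[of a] a PA cQ by auto
  qed (use f f52 c(7) n_ge PA in auto)
  moreover have "card P = card (P \<inter> low A) + card (P - low A)"
    using card_Int_Diff[OF PA(2)] .
  ultimately have cPlow: "card (P \<inter> low A) > 13" using cP f52 by linarith
  \<comment> \<open>Apart from \<open>z\<close>, the vertices that might not be matched on one side are not adjacent to
      low vertices of \<open>P\<close> or \<open>Q\<close> on the other side, and none is bad for both sides. The values 14 and 18 are
      \<open>2n + 8 - card A\<close> and \<open>2n + 8 - card B\<close>.\<close>
  have obstructA: "card (A - nb e) \<ge> 14" if "b \<in> Q \<inter> low B" "adj b e" "e \<noteq> z" for b e
  proof (rule ccontr)
    assume "\<not> ?thesis"
    then have "card (A - nb b) + card (A - nb e) < card P"
      using misA[of b] that cP f52 by (auto simp: low_def)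
    then obtain a where "a \<in> P" "adj b a" "adj e a" using meetP by blast
    then show False using unique[of a b e] that adj_sym by auto
  qed
  have obstructB: "card (B - nb e) \<ge> 18" if "a \<in> P \<inter> low A" "adj a e" "e \<noteq> z" for a e
  proof (rule ccontr)
    assume "\<not> ?thesis"
    then have "card (B - nb a) + card (B - nb e) < card Q"
      using misB[of a] that cQ f52 by (auto simp: low_def)
    then obtain b where "b \<in> Q" "adj a b" "adj e b" using meetQ by blast
    then show False using unique[of a b e] that adj_sym by auto
  qed
  have obstruct: "card (A - nb e) \<ge> 14 \<or> card (B - nb e) \<ge> 18" if "e \<noteq> z" for e
  proof (rule ccontr)
    assume no: "\<not> ?thesis"
    then have "card (A - nb e) < card (P \<inter> low A)" using cPlow by linarith
    then obtain a where "a \<in> P \<inter> low A" "a \<notin> A - nb e"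
      using obtain_outside[OF finite_Diff[OF c(9)]] by blast
    then show False using obstructB[of a e] no that PA adj_sym by auto
  qed
  obtain a where a: "a \<in> P \<inter> low A" using obtain_outside[OF finite.emptyI, of "P \<inter> low A"] cPlow by auto
  have "card (B - nb a) < card (Q \<inter> low B)" using misB[of a] a cQlow by (simp add: low_def)
  then obtain b where b: "b \<in> Q \<inter> low B" "b \<notin> B - nb a"
    using obtain_outside[OF finite_Diff[OF c(10)]] by blast
  have ab: "adj a b" using b QB by auto
  define MA where "MA = {v \<in> V. v \<noteq> a \<and> \<not> adj a v \<and> 2 * n + 8 \<le> card A + card (A - nb v)}"
  define MB where "MB = {v \<in> V. v \<noteq> b \<and> \<not> adj b v \<and> 2 * n + 8 \<le> card B + card (B - nb v)}"
  have "V - {a, b, z} \<subseteq> MA \<union> MB"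
  proof
    fix v assume v: "v \<in> V - {a, b, z}"
    have iff: "2 * n + 8 \<le> card A + card (A - nb v) \<longleftrightarrow> 14 \<le> card (A - nb v)"
      "2 * n + 8 \<le> card B + card (B - nb v) \<longleftrightarrow> 18 \<le> card (B - nb v)"
      using c(7,8) by linarith+
    have "\<not> (adj a v \<and> adj b v)" using unique[of a b v] a b v ab adj_sym by auto
    then show "v \<in> MA \<union> MB"
      unfolding MA_def MB_def Un_iff mem_Collect_eq iff
      using v obstructA[of b v] obstructB[of a v] obstruct[of v] a b(1) by blast
  qed
  moreover have "finite MA" "finite MB" using finite_V by (auto simp: MA_def MB_def)
  ultimately have "card (V - {a, b, z}) \<le> card (MA \<union> MB)" by (intro card_mono) auto
  moreover have "card (MA \<union> MB) \<le> card MA + card MB" by (rule card_Un_le)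
  moreover have "card MA < 2 * n"
    unfolding MA_def by (rule few_obstructed_nonneighbours) (use c a in auto)
  moreover have "card MB < 2 * n"
    unfolding MB_def by (rule few_obstructed_nonneighbours) (use c b in auto)
  moreover have "card V - card {a, b, z} \<le> card (V - {a, b, z})"
    by (intro diff_card_le_card_Diff) auto
  moreover have "card {a, b, z} \<le> 3" by (simp add: card_insert_if)
  ultimately show False using card_V by linarith
qed


section \<open>The exact bipartition\<close>

text \<open>
  If every vertex of \<open>X\<close> misses less than a quarter of \<open>B\<close>, then any four of them have a
  common neighbour, and paths on four vertices and triangles are excluded as in the common
  neighbourhood of two vertices.
\<close>

lemma sparse_side_star_forest:
  assumes B: "2 * n \<le> card B + 10" "4 * f + 11 \<le> 2 * n" "finite B"
    and mis: "\<And>x. x \<in> X \<Longrightarrow> card (B - nb x) \<le> f"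
  shows "star_forest X"
    and "\<And>u v w. u \<in> X \<Longrightarrow> v \<in> X \<Longrightarrow> w \<in> X \<Longrightarrow> \<exists>b\<in>B. adj u b \<and> adj v b \<and> adj w b"
    and "\<And>u v. u \<in> X \<Longrightarrow> v \<in> X \<Longrightarrow> card (nb u \<inter> nb v) \<ge> 4"
proof -
  have four: "\<exists>y\<in>B. adj a y \<and> adj b y \<and> adj c y \<and> adj d y"
    if X: "a \<in> X" "b \<in> X" "c \<in> X" "d \<in> X" for a b c d
  proof -
    have "card ((B - nb a) \<union> (B - nb b)) \<le> card (B - nb a) + card (B - nb b)"
      "card ((B - nb c) \<union> (B - nb d)) \<le> card (B - nb c) + card (B - nb d)"
      by (rule card_Un_le)+
    then have lt: "card ((B - nb a) \<union> (B - nb b)) + card ((B - nb c) \<union> (B - nb d)) < card B"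
      using mis[OF X(1)] mis[OF X(2)] mis[OF X(3)] mis[OF X(4)] B(1,2) by linarith
    have "finite ((B - nb a) \<union> (B - nb b))" "finite ((B - nb c) \<union> (B - nb d))"
      using B(3) by auto
    from ex_outside_two[OF this lt] show ?thesis by (metis DiffI UnI1 UnI2 nb_iff)
  qed
  show codeg: "card (nb u \<inter> nb v) \<ge> 4" if X: "u \<in> X" "v \<in> X" for u v
  proof -
    have "card B \<le> card ((nb u \<inter> nb v) \<union> ((B - nb u) \<union> (B - nb v)))"
      using B(3) by (intro card_mono) auto
    also have "\<dots> \<le> card (nb u \<inter> nb v) + card ((B - nb u) \<union> (B - nb v))" by (rule card_Un_le)
    also have "card ((B - nb u) \<union> (B - nb v)) \<le> card (B - nb u) + card (B - nb v)" by (rule card_Un_le)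
    finally show ?thesis using mis[OF X(1)] mis[OF X(2)] B(1,2) n_ge by linarith
  qed
  show "\<exists>b\<in>B. adj u b \<and> adj v b \<and> adj w b" if "u \<in> X" "v \<in> X" "w \<in> X" for u v w
    using four[of u v w w] that by blast
  show "star_forest X"
  proof (rule star_forestI)
    fix a b c assume abc: "a \<in> X" "b \<in> X" "c \<in> X" "adj a b" "adj b c" "adj c a"
    have "card (nb b \<inter> nb c) \<ge> 3" using codeg[of b c] abc by simp
    obtain z where "z \<in> nb c \<inter> nb a" "z \<notin> {b}"
      using obtain_outside[of "{b}" "nb c \<inter> nb a"] codeg[of c a] abc by auto
    then show False
      using no_hajos_codegree[of a b c z] codeg[of a b] \<open>card (nb b \<inter> nb c) \<ge> 3\<close> abc adj_sym by auto
  next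
    fix a b c d assume X: "a \<in> X" "b \<in> X" "c \<in> X" "d \<in> X"
      and path: "adj a b" "adj b c" "adj c d" "a \<noteq> c" "b \<noteq> d" "a \<noteq> d"
    obtain y where y: "y \<in> B" "adj a y" "adj b y" "adj c y" "adj d y" using four X by blast
    have "card {y, a, d} < card (nb b \<inter> nb c)"
      using codeg[of b c] X by (simp add: card_insert_if)
    then obtain y' where y': "y' \<in> nb b \<inter> nb c" "y' \<notin> {y, a, d}"
      using obtain_outside[of "{y, a, d}"] by blast
    show False
      by (rule no_hajos[of y b c a y' d]) (use y y' path adj_sym in auto)
  qed
qed

text \<open>
  Otherwise \<open>2n\<close> of the non-neighbours of \<open>x\<close> in \<open>X\<close> form a sparse star forest, and the
  matching of its complement completes a fan with centre \<open>x\<close>.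
\<close>

lemma low_degree_bound:
  assumes X: "X \<subseteq> V" "star_forest X" and sparse: "\<And>x. x \<in> X \<Longrightarrow> card (nb x \<inter> X) \<le> n"
    and x: "x \<in> X"
  shows "card X \<le> 2 * n + card (nb x \<inter> X)"
proof (rule ccontr)
  assume large: "\<not> ?thesis"
  have finX: "finite X" using X(1) finite_sub by blast
  have "insert x (nb x \<inter> X) \<subseteq> X" "card (insert x (nb x \<inter> X)) = card (nb x \<inter> X) + 1"
    using x adj_irrefl by auto
  then have "card (X - insert x (nb x \<inter> X)) = card X - (card (nb x \<inter> X) + 1)"
    using finX card_Diff_subset[of "insert x (nb x \<inter> X)" X] by auto
  then have "2 * n \<le> card (X - insert x (nb x \<inter> X))" using large by linarith
  then obtain S where S: "S \<subseteq> X - insert x (nb x \<inter> X)" "card S = 2 * n" "finite S"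
    by (rule obtain_subset_with_card_n) blast
  have "matchable nonadj S"
  proof (rule star_forest_matchable[OF S(3)])
    show "star_forest S" using X(2) S(1) star_forest_subset by blast
    show "even (card S)" using S(2) by simp
    fix v assume v: "v \<in> S"
    have "card S = card (S \<inter> nb v) + card (S - nb v)" by (rule card_Int_Diff[OF S(3)])
    moreover have "card (S \<inter> nb v) \<le> card (nb v \<inter> X)"
      using S(1) by (intro card_mono) auto
    ultimately show "2 \<le> card (S - nb v)" using sparse[of v] v S n_ge by auto
  qed
  moreover have "S \<subseteq> V" "x \<notin> S" "S \<inter> nb x = {}" "x \<in> V" using S(1) X(1) x by auto
  ultimately show False using no_fan[of x S] S(2) by blast
qed

lemma side_card_le:
  assumes "X \<subseteq> V" "star_forest X" "\<And>x. x \<in> X \<Longrightarrow> card (nb x \<inter> X) \<le> n"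
  shows "card X \<le> 2 * n + 1"
proof (cases "card X \<ge> 2")
  case True
  then obtain u v where "u \<in> low X" "v \<in> low X" "u \<noteq> v"
    using star_forest_two_low[OF assms(2)] by blast
  then have "u \<in> X" "card (nb u \<inter> X) \<le> 1" by (auto simp: low_def)
  then show ?thesis using low_degree_bound[OF assms, of u] by simp
qed simp

text \<open>
  Both sides have exactly \<open>2n + 1\<close> vertices and no vertex is isolated in its side. As \<open>2n + 1\<close>
  is odd, \<open>X\<close> is not a perfect matching, so there is a centre \<open>x\<close> with two leaves \<open>l\<close>, \<open>l'\<close>.
  Take a common neighbour \<open>b \<in> Y\<close> of these three and a neighbour \<open>b' \<in> Y\<close> of \<open>b\<close>. If \<open>b'\<close> is
  adjacent to \<open>l\<close>, then the triangle \<open>x, l, b\<close> extends to a Hajos graph, with \<open>l'\<close> attached to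
  \<open>x, b\<close> and \<open>b'\<close> attached to \<open>l, b\<close>; likewise for \<open>l'\<close>. If \<open>b'\<close> is adjacent to neither, then
  replacing \<open>x\<close> by \<open>b'\<close> among the vertices of \<open>X\<close> other than \<open>l\<close> gives \<open>2n\<close> non-neighbours of
  \<open>l\<close>, in which \<open>b'\<close> is matched with \<open>l'\<close>.
\<close>

lemma no_sparse_split:
  assumes part: "X \<union> Y = V" "X \<inter> Y = {}"
    and sides: "2 * n \<le> card A + 10" "2 * n \<le> card B + 10" "finite A" "finite B" and f: "4 * f + 11 \<le> 2 * n"
    and mis: "\<And>x. x \<in> X \<Longrightarrow> card (B - nb x) \<le> f" "\<And>y. y \<in> Y \<Longrightarrow> card (A - nb y) \<le> f"
    and sparse: "\<And>x. x \<in> X \<Longrightarrow> card (nb x \<inter> X) \<le> n" "\<And>y. y \<in> Y \<Longrightarrow> card (nb y \<inter> Y) \<le> n"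
    and BV: "B \<subseteq> V"
  shows False
proof -
  have XV: "X \<subseteq> V" "Y \<subseteq> V" "finite X" using part finite_V by auto
  note sfX = sparse_side_star_forest[OF sides(2) f sides(4) mis(1), of X]
  note sfY = sparse_side_star_forest[OF sides(1) f sides(3) mis(2), of Y]
  have X: "star_forest X" and Y: "star_forest Y" using sfX(1) sfY(1) by blast+
  have "card X + card Y = 4 * n + 2"
    using card_Un_disjoint[of X Y] part XV card_V finite_sub by auto
  then have cX: "card X = 2 * n + 1" and cY: "card Y = 2 * n + 1"
    using side_card_le[OF XV(1) X sparse(1)] side_card_le[OF XV(2) Y sparse(2)] by auto
  have degX: "card (nb x \<inter> X) \<ge> 1" if "x \<in> X" for x
    using low_degree_bound[OF XV(1) X sparse(1) that] cX by simp
  have degY: "card (nb y \<inter> Y) \<ge> 1" if "y \<in> Y" for y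
    using low_degree_bound[OF XV(2) Y sparse(2) that] cY by simp
  have "\<exists>x\<in>X. card (nb x \<inter> X) \<ge> 2"
  proof (rule ccontr)
    assume "\<not> ?thesis"
    then have "\<forall>x\<in>X. \<exists>y. nb x \<inter> X = {y}"
      using degX by (metis One_nat_def card_1_singletonE le_antisym not_less_eq_eq numeral_2_eq_2)
    then obtain \<sigma> where \<sigma>: "\<And>x. x \<in> X \<Longrightarrow> nb x \<inter> X = {\<sigma> x}" by metis
    have s: "\<sigma> x \<in> X" "adj x (\<sigma> x)" if "x \<in> X" for x using \<sigma>[OF that] by auto
    have "\<sigma> (\<sigma> x) = x" if "x \<in> X" for x
    proof -
      have "x \<in> nb (\<sigma> x) \<inter> X" using s[OF that] that adj_sym by simp
      then show ?thesis using \<sigma>[OF s(1)[OF that]] by (metis singletonD)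
    qed
    then have "pairing adj \<sigma> X" unfolding pairing_def using s adj_irrefl by metis
    then show False using matchable_even[OF XV(3), of adj] cX by (auto simp: matchable_def)
  qed
  then obtain x where x: "x \<in> X" "card (nb x \<inter> X) \<ge> 2" by blast
  then obtain l l' where l0: "l \<in> nb x \<inter> X" "l' \<in> nb x \<inter> X" "l \<noteq> l'" by (elim obtain_two)
  then have l: "l \<in> X" "l' \<in> X" "adj x l" "adj x l'" "adj l x" "adj l' x" using adj_sym by auto
  have leaf: "nb l \<inter> X = {x}" "nb l' \<inter> X = {x}"
    using star_forest_leaf[OF X l(1) x(1) l(5) x(2)] star_forest_leaf[OF X l(2) x(1) l(6) x(2)] .
  obtain b where b: "b \<in> B" "adj x b" "adj l b" "adj l' b"
    using sfX(2)[OF _ x(1) l(1,2)] by blast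
  have "b \<notin> X"
  proof
    assume "b \<in> X"
    then have "b \<in> nb l \<inter> X" using b by simp
    then show False using leaf(1) b(2) adj_irrefl by (metis singletonD)
  qed
  then have bY: "b \<in> Y" using b(1) BV part by blast
  then obtain b' where b': "b' \<in> nb b \<inter> Y"
    using degY[of b] by (metis card.empty ex_in_conv not_one_le_zero)
  have b'X: "b' \<notin> X" using b' part by blast
  have no: False if k: "k \<in> X" "k' \<in> X" "k \<noteq> k'" "adj x k" "adj x k'" "adj k b" "adj k' b" "adj b' k" for k k'
  proof -
    have "card {b, b', k'} < card (nb x \<inter> nb k)"
      using sfX(3)[OF _ x(1) k(1)] by (simp add: card_insert_if le_less_trans)
    then obtain w where w: "w \<in> nb x \<inter> nb k" "w \<notin> {b, b', k'}"
      using obtain_outside[of "{b, b', k'}"] by blast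
    show False
      by (rule no_hajos[of x k b w b' k']) (use k w b b' b'X x(1) adj_sym in auto)
  qed
  have nadj: "\<not> adj b' l" "\<not> adj b' l'"
    using no[of l l'] no[of l' l] l b l0(3) by auto
  define R where "R = X - {l, x, l'}"
  have dist: "l \<noteq> x" "l' \<noteq> x" using l adj_irrefl by auto
  have cR: "card R = 2 * n - 2" and finR: "finite R"
    unfolding R_def using l x(1) l0(3) dist XV(3) cX by (auto simp: card_Diff_subset)
  have "matchable nonadj R"
  proof (rule star_forest_matchable[OF finR])
    show "star_forest R" using X star_forest_subset R_def by blast
    show "even (card R)" using cR by simp
    fix v assume v: "v \<in> R"
    have "card R = card (R \<inter> nb v) + card (R - nb v)" by (rule card_Int_Diff[OF finR])
    moreover have "card (R \<inter> nb v) \<le> card (nb v \<inter> X)"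
      by (intro card_mono) (auto simp: R_def)
    ultimately show "2 \<le> card (R - nb v)" using sparse(1)[of v] v cR n_ge by (auto simp: R_def)
  qed
  then have "matchable nonadj (insert b' (insert l' R))"
    by (rule matchable_insert_pair) (use nadj b'X l adj_sym in \<open>auto simp: R_def\<close>)
  moreover have "card (insert b' (insert l' R)) = 2 * n"
    using finR cR b'X l n_ge by (subst card_insert_disjoint; auto simp: R_def)+
  moreover have "insert b' (insert l' R) \<subseteq> V" using b' l XV by (auto simp: R_def)
  moreover have "l \<notin> insert b' (insert l' R)" using b'X l l0(3) by (auto simp: R_def)
  moreover have "insert b' (insert l' R) \<inter> nb l = {}"
  proof (rule ccontr)
    assume "\<not> ?thesis"
    then obtain v where "v \<in> insert b' (insert l' R) \<inter> nb l" by blast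
    then have v: "v \<in> insert b' (insert l' R)" "adj l v" by auto
    then have "v \<noteq> b'" using nadj adj_sym by blast
    then have "v \<in> nb l \<inter> X" "v \<noteq> x" using v l dist by (auto simp: R_def)
    then show False using leaf(1) by blast
  qed
  ultimately show False using no_fan[of l "insert b' (insert l' R)"] l XV by blast
qed

text \<open>
  Every vertex sees little of one part of the core, hence, by its degree, more than three
  quarters of the other part. This sorts all vertices, including the 18 outside the core, into
  two sides. At most one vertex of each part of the core changes sides, since it must be the
  centre of a star that covers most of its part.
\<close>

lemma impossible: False
proof -
  obtain A B where core: "core A B" using core_exists by blast
  note c = coreD[OF core]
  define f where "f = (2 * n - 11) div 4"
  have f: "4 * f + 11 \<le> 2 * n" "2 * n < 4 * f + 15" using n_ge by (auto simp: f_def)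
  have f52: "f \<ge> 52" using f n_ge by linarith
  define X where "X = {z \<in> V. card (nb z \<inter> A) + 7 < f}"
  define Y where "Y = V - X"
  define Z where "Z = V - A - B"
  have XY: "X \<union> Y = V" "X \<inter> Y = {}" by (auto simp: X_def Y_def)
  have cZ: "card Z = 18"
  proof -
    have "card (A \<union> B) = card A + card B" using c by (intro card_Un_disjoint) auto
    moreover have "V - A - B = V - (A \<union> B)" by auto
    ultimately show ?thesis using card_Diff_V[of "A \<union> B"] c by (simp add: Z_def)
  qed
  have finZ: "finite Z" using finite_V by (simp add: Z_def)
  have Yfew: "card (nb z \<inter> B) + 11 < f" if "z \<in> Y" for z
  proof (rule ccontr)
    assume "\<not> ?thesis"
    moreover have "z \<in> V" "f \<le> card (nb z \<inter> A) + 7"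
      using that by (auto simp: X_def Y_def)
    ultimately show False using core_separates[OF core _ f, of z] by simp
  qed
  have cover: "card (nb z \<inter> S) \<le> card (nb z \<inter> A) + card (nb z \<inter> B) + 18" if "S \<subseteq> V" for z S
  proof -
    have "card (nb z \<inter> S) \<le> card ((nb z \<inter> A) \<union> (nb z \<inter> B) \<union> Z)"
      using that c finZ by (intro card_mono) (auto simp: Z_def)
    also have "\<dots> \<le> card ((nb z \<inter> A) \<union> (nb z \<inter> B)) + card Z" by (rule card_Un_le)
    also have "card ((nb z \<inter> A) \<union> (nb z \<inter> B)) \<le> card (nb z \<inter> A) + card (nb z \<inter> B)" by (rule card_Un_le)
    finally show ?thesis using cZ by simp
  qed
  have deg: "2 * n \<le> card (nb z \<inter> A) + card (nb z \<inter> B) + 18" if "z \<in> V" for z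
    using degree_ge[OF that] cover[of V z] nb_subset[of z] by (simp add: Int_absorb2)
  have sA: "card A = card (nb z \<inter> A) + card (A - nb z)" for z
    using card_Int_Diff[OF c(9), of "nb z"] by (simp add: Int_commute)
  have sB: "card B = card (nb z \<inter> B) + card (B - nb z)" for z
    using card_Int_Diff[OF c(10), of "nb z"] by (simp add: Int_commute)
  have misX: "card (B - nb x) \<le> f" if "x \<in> X" for x
    using deg[of x] sB[of x] that c(8) by (auto simp: X_def)
  have misY: "card (A - nb y) \<le> f" if "y \<in> Y" for y
    using deg[of y] sA[of y] Yfew[OF that] that c(7) by (auto simp: Y_def)
  have "card (X \<inter> B) < 2"
  proof (rule big_centres_less[OF c(6,10)])
    fix b assume "b \<in> X \<inter> B"
    then show "card B - f \<le> card (nb b \<inter> B)" using misX[of b] sB[of b] by auto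
  qed (use c(8) f n_ge in auto)
  have "card (Y \<inter> A) < 2"
  proof (rule big_centres_less[OF c(5,9)])
    fix a assume "a \<in> Y \<inter> A"
    then show "card A - f \<le> card (nb a \<inter> A)" using misY[of a] sA[of a] by auto
  qed (use c(7) f n_ge in auto)
  have split: "card (nb z \<inter> S) \<le> card (nb z \<inter> T) + card (S \<inter> T') + 18"
    if "S \<subseteq> V" "T \<union> T' = A \<union> B" "finite T" "finite T'" for z S T T'
  proof -
    have "card (nb z \<inter> S) \<le> card ((nb z \<inter> T) \<union> (S \<inter> T') \<union> Z)"
      using that finZ by (intro card_mono) (auto simp: Z_def)
    also have "\<dots> \<le> card ((nb z \<inter> T) \<union> (S \<inter> T')) + card Z" by (rule card_Un_le)
    also have "card ((nb z \<inter> T) \<union> (S \<inter> T')) \<le> card (nb z \<inter> T) + card (S \<inter> T')" by (rule card_Un_le)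
    finally show ?thesis using cZ by simp
  qed
  have XYV: "X \<subseteq> V" "Y \<subseteq> V" by (auto simp: X_def Y_def)
  show False
  proof (rule no_sparse_split[OF XY _ _ c(9,10) f(1) misX misY])
    show "card (nb x \<inter> X) \<le> n" if "x \<in> X" for x
    proof -
      have "card (nb x \<inter> A) + 7 < f" using that by (simp add: X_def)
      then show ?thesis
        using split[OF XYV(1) refl c(9,10), of x] \<open>card (X \<inter> B) < 2\<close> f(1) n_ge by linarith
    qed
    show "card (nb y \<inter> Y) \<le> n" if "y \<in> Y" for y
      using split[OF XYV(2) Un_commute c(10,9), of y] \<open>card (Y \<inter> A) < 2\<close> Yfew[OF that] f(1) n_ge by linarith
  qed (use c in auto)
qed

end

section \<open>The two bounds\<close>

lemma simple_graph_edgeD: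
  assumes "simple_graph G" "{u, v} \<in> edges G"
  shows "u \<noteq> v \<and> u \<in> verts G \<and> v \<in> verts G"
proof -
  have "{u, v} \<in> [verts G]\<^bsup>2\<^esup>"
    using assms unfolding simple_graph_def by blast
  then show ?thesis by (auto simp: nsets_def card_insert_if split: if_splits)
qed

lemma contains_hajosI:
  assumes E: "{a, b} \<in> edges \<Gamma>" "{b, c} \<in> edges \<Gamma>" "{c, a} \<in> edges \<Gamma>" "{x, a} \<in> edges \<Gamma>"
      "{x, b} \<in> edges \<Gamma>" "{y, b} \<in> edges \<Gamma>" "{y, c} \<in> edges \<Gamma>" "{z, c} \<in> edges \<Gamma>" "{z, a} \<in> edges \<Gamma>"
    and ne: "x \<noteq> c" "y \<noteq> a" "z \<noteq> b" "x \<noteq> y" "y \<noteq> z" "x \<noteq> z" and simple: "simple_graph \<Gamma>"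
  shows "contains_graph \<Gamma> hajos_graph"
proof -
  note e = simple_graph_edgeD[OF simple]
  note d = e[OF E(1)] e[OF E(2)] e[OF E(3)] e[OF E(4)] e[OF E(5)] e[OF E(6)] e[OF E(7)] e[OF E(8)] e[OF E(9)]
  define f where "f = (\<lambda>i::nat. [a, b, c, x, y, z] ! i)"
  have f: "f 0 = a" "f 1 = b" "f 2 = c" "f 3 = x" "f 4 = y" "f 5 = z"
    by (simp_all add: f_def)
  have "inj_on f (verts hajos_graph)"
    using d ne by (auto simp: hajos_graph_def inj_on_def f simp del: One_nat_def)
  moreover have "f ` verts hajos_graph \<subseteq> verts \<Gamma>"
    using d by (auto simp: hajos_graph_def f simp del: One_nat_def)
  moreover have "\<forall>e\<in>edges hajos_graph. f ` e \<in> edges \<Gamma>"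
    using E by (auto simp: hajos_graph_def f simp del: One_nat_def)
  ultimately show ?thesis unfolding contains_graph_def by blast
qed

lemma contains_fanI:
  assumes v: "v \<in> verts \<Gamma>" "v \<notin> S" and S: "S \<subseteq> verts \<Gamma>" "finite S" "card S = 2 * n"
    and spokes: "\<And>s. s \<in> S \<Longrightarrow> {v, s} \<in> edges \<Gamma>"
    and m: "matchable R S" "\<And>s t. s \<in> S \<Longrightarrow> t \<in> S \<Longrightarrow> s \<noteq> t \<Longrightarrow> R s t \<Longrightarrow> {s, t} \<in> edges \<Gamma>"
  shows "contains_graph \<Gamma> (fan_graph n)"
proof -
  obtain h where h: "inj_on h {1..2 * n}" "h ` {1..2 * n} = S"
    "\<forall>i<n. R (h (2 * i + 1)) (h (2 * i + 2))"
    using matchable_enumeration[OF S(2) m(1) S(3)] by blast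
  define f where "f = (\<lambda>i. if i = 0 then v else h i)"
  have hS: "h i \<in> S" if "1 \<le> i" "i \<le> 2 * n" for i using h(2) that by auto
  have verts: "verts (fan_graph n) = insert 0 {1..2 * n}" by (auto simp: fan_graph_def)
  have f0: "f 0 = v" and fh: "\<And>i. i \<noteq> 0 \<Longrightarrow> f i = h i" by (auto simp: f_def)
  have im: "f ` {1..2 * n} = S" using h(2) fh by (metis (no_types, lifting) atLeastAtMost_iff image_cong not_one_le_zero)
  have "inj_on f {1..2 * n}" using h(1) fh by (metis (no_types, lifting) atLeastAtMost_iff inj_on_cong not_one_le_zero)
  then have "inj_on f (verts (fan_graph n))"
    unfolding verts using im f0 v(2) by (subst inj_on_insert) auto
  moreover have "f ` verts (fan_graph n) \<subseteq> verts \<Gamma>"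
    unfolding verts image_insert im f0 using v S by auto
  moreover have "f ` e \<in> edges \<Gamma>" if "e \<in> edges (fan_graph n)" for e
  proof -
    have "(\<exists>i. e = {0, i} \<and> 1 \<le> i \<and> i \<le> 2 * n) \<or> (\<exists>i. e = {2 * i + 1, 2 * i + 2} \<and> i < n)"
      using that by (auto simp: fan_graph_def)
    then consider i where "e = {0, i}" "1 \<le> i" "i \<le> 2 * n" | i where "e = {2 * i + 1, 2 * i + 2}" "i < n"
      by blast
    then show ?thesis
    proof cases
      case 1
      then show ?thesis using spokes hS[of i] f0 fh[of i] by simp
    next
      case 2
      have "h (2 * i + 1) \<noteq> h (2 * i + 2)"
        using inj_onD[OF h(1), of "2 * i + 1" "2 * i + 2"] 2 by auto
      then have "{h (2 * i + 1), h (2 * i + 2)} \<in> edges \<Gamma>"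
        using h(3) 2 hS[of "2 * i + 1"] hS[of "2 * i + 2"] by (intro m(2)) auto
      then show ?thesis using 2 fh by simp
    qed
  qed
  ultimately show ?thesis unfolding contains_graph_def by blast
qed

lemma hajos_fan_upper:
  assumes "n \<ge> 111"
  shows "ramsey_bound hajos_graph (fan_graph n) (4 * n + 2)"
  unfolding ramsey_bound_def
proof (intro allI impI, rule ccontr)
  fix \<Gamma> :: "nat graph"
  assume \<Gamma>: "simple_graph \<Gamma> \<and> card (verts \<Gamma>) = 4 * n + 2"
    and no: "\<not> (contains_graph \<Gamma> hajos_graph \<or> contains_graph (graph_complement \<Gamma>) (fan_graph n))"
  note e = simple_graph_edgeD[OF conjunct1[OF \<Gamma>]]
  have co: "{u, v} \<in> edges (graph_complement \<Gamma>)"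
    if "u \<in> verts \<Gamma>" "v \<in> verts \<Gamma>" "u \<noteq> v" "{u, v} \<notin> edges \<Gamma>" for u v
    using that by (auto simp: graph_complement_def nsets_def card_insert_if)
  interpret g: graph "verts \<Gamma>" "\<lambda>u v. {u, v} \<in> edges \<Gamma>"
  proof unfold_locales
    show "finite (verts \<Gamma>)" using \<Gamma> by (simp add: simple_graph_def)
    show "{v, u} \<in> edges \<Gamma>" if "{u, v} \<in> edges \<Gamma>" for u v
      using that by (simp add: insert_commute)
    show "{v, v} \<notin> edges \<Gamma>" for v using e[of v v] by blast
    show "u \<in> verts \<Gamma>" if "{u, v} \<in> edges \<Gamma>" for u v using e[OF that] by blast
  qed
  interpret critical_graph "verts \<Gamma>" "\<lambda>u v. {u, v} \<in> edges \<Gamma>" n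
  proof unfold_locales
    show "111 \<le> n" by (rule assms)
    show "card (verts \<Gamma>) = 4 * n + 2" using \<Gamma> by simp
    show False
      if "{a, b} \<in> edges \<Gamma>" "{b, c} \<in> edges \<Gamma>" "{c, a} \<in> edges \<Gamma>" "{x, a} \<in> edges \<Gamma>"
        "{x, b} \<in> edges \<Gamma>" "{y, b} \<in> edges \<Gamma>" "{y, c} \<in> edges \<Gamma>" "{z, c} \<in> edges \<Gamma>" "{z, a} \<in> edges \<Gamma>"
        "x \<noteq> c" "y \<noteq> a" "z \<noteq> b" "x \<noteq> y" "y \<noteq> z" "x \<noteq> z" for a b c x y z
      using contains_hajosI[OF that] \<Gamma> no by blast
    show False
      if v: "v \<in> verts \<Gamma>" "v \<notin> S" and S: "S \<subseteq> verts \<Gamma>" "S \<inter> g.nb v = {}"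
        and m: "matchable (\<lambda>u v. {u, v} \<notin> edges \<Gamma>) S" "card S = 2 * n" for v S
    proof -
      have "contains_graph (graph_complement \<Gamma>) (fan_graph n)"
      proof (rule contains_fanI[OF _ v(2) _ _ m(2) _ m(1)])
        show "v \<in> verts (graph_complement \<Gamma>)" "S \<subseteq> verts (graph_complement \<Gamma>)" "finite S"
          using v S g.finite_V finite_subset by (auto simp: graph_complement_def)
        show "{v, s} \<in> edges (graph_complement \<Gamma>)" if "s \<in> S" for s
          using that v S by (intro co) (auto simp: disjoint_iff)
        show "{s, t} \<in> edges (graph_complement \<Gamma>)"
          if "s \<in> S" "t \<in> S" "s \<noteq> t" "{s, t} \<notin> edges \<Gamma>" for s t
          using that S by (intro co) auto
      qed
      then show False using no by blast
    qed
  qed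
  show False by (rule impossible)
qed

text \<open>
  The join of a single vertex with the complete bipartite graph on two classes of size \<open>2n\<close>,
  cut down to the first \<open>N\<close> vertices so that one construction serves all \<open>N \<le> 4n + 1\<close>.
\<close>

definition part :: "nat \<Rightarrow> nat \<Rightarrow> nat" where
  "part n i = (if i = 0 then 0 else if i \<le> 2 * n then 1 else 2)"

definition tripartite_graph :: "nat \<Rightarrow> nat \<Rightarrow> nat graph" where
  "tripartite_graph n N =
     ({0..<N}, {{u, v} |u v. u < N \<and> v < N \<and> part n u \<noteq> part n v})"

lemma tripartite_edge_iff:
  "{u, v} \<in> edges (tripartite_graph n N) \<longleftrightarrow> u < N \<and> v < N \<and> part n u \<noteq> part n v"
  by (auto simp: tripartite_graph_def doubleton_eq_iff)

text \<open>
  Each triangle uses all three classes and hence the vertex \<open>0\<close>, but no vertex of the Hajos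
  graph lies on all of its triangles.
\<close>

lemma tripartite_no_hajos: "\<not> contains_graph (tripartite_graph n N) hajos_graph"
proof
  assume "contains_graph (tripartite_graph n N) hajos_graph"
  then obtain f where inj: "inj_on f (verts hajos_graph)"
    and E: "\<forall>e\<in>edges hajos_graph. f ` e \<in> edges (tripartite_graph n N)"
    unfolding contains_graph_def by blast
  have adjs: "part n (f i) \<noteq> part n (f j)" if "{i, j} \<in> edges hajos_graph" for i j
  proof -
    have "{f i, f j} \<in> edges (tripartite_graph n N)" using E that by fastforce
    then show ?thesis by (simp add: tripartite_edge_iff)
  qed
  have triangle: "0 \<in> f ` {i, j, k}"
    if "{i, j} \<in> edges hajos_graph" "{j, k} \<in> edges hajos_graph" "{i, k} \<in> edges hajos_graph" for i j k
    using adjs[OF that(1)] adjs[OF that(2)] adjs[OF that(3)] by (auto simp: part_def split: if_splits)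
  have "0 \<in> f ` {0, 1, 3}" "0 \<in> f ` {1, 2, 4}" "0 \<in> f ` {2, 0, 5}"
    by (rule triangle; simp add: hajos_graph_def insert_commute)+
  then show False
    using inj by (auto simp: hajos_graph_def inj_on_def)
qed

text \<open>
  In the complement the centre of a fan sees only its own class, which has at most \<open>2n\<close>
  vertices.
\<close>

lemma tripartite_complement_no_fan:
  assumes "n \<ge> 1" "N \<le> 4 * n + 1"
  shows "\<not> contains_graph (graph_complement (tripartite_graph n N)) (fan_graph n)"
proof
  assume "contains_graph (graph_complement (tripartite_graph n N)) (fan_graph n)"
  then obtain f where inj: "inj_on f (verts (fan_graph n))"
    and im: "f ` verts (fan_graph n) \<subseteq> {0..<N}"
    and E: "\<forall>e\<in>edges (fan_graph n). f ` e \<in> edges (graph_complement (tripartite_graph n N))"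
    unfolding contains_graph_def by (auto simp: graph_complement_def tripartite_graph_def)
  have "part n (f i) = part n (f 0)" if "i \<in> verts (fan_graph n)" for i
  proof (cases "i = 0")
    case False
    then have "{0, i} \<in> edges (fan_graph n)" using that by (auto simp: fan_graph_def)
    then have "{f 0, f i} \<notin> edges (tripartite_graph n N)"
      using E by (fastforce simp: graph_complement_def)
    moreover have "f 0 \<in> {0..<N}" "f i \<in> {0..<N}"
      using im that by (auto simp: fan_graph_def image_subset_iff)
    ultimately show ?thesis by (simp add: tripartite_edge_iff)
  qed simp
  then have "f ` verts (fan_graph n) \<subseteq> {j. j < N \<and> part n j = part n (f 0)}"
    using im by auto
  moreover have "finite {j. j < N \<and> part n j = part n (f 0)}" by simp
  ultimately have "card (f ` verts (fan_graph n)) \<le> card {j. j < N \<and> part n j = part n (f 0)}"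
    by (rule card_mono[rotated])
  moreover have "card (f ` verts (fan_graph n)) = 2 * n + 1"
    using card_image[OF inj] by (simp add: fan_graph_def)
  moreover have "card {j. j < N \<and> part n j = p} \<le> 2 * n" for p
  proof -
    have "{j. j < N \<and> part n j = p} \<subseteq> {0} \<or> {j. j < N \<and> part n j = p} \<subseteq> {1..2 * n}
        \<or> {j. j < N \<and> part n j = p} \<subseteq> {2 * n + 1..4 * n}"
      using assms by (auto simp: part_def split: if_splits)
    then show ?thesis
    proof (elim disjE)
      assume "{j. j < N \<and> part n j = p} \<subseteq> {0}"
      from card_mono[OF _ this] show ?thesis using assms by simp
    next
      assume "{j. j < N \<and> part n j = p} \<subseteq> {1..2 * n}"
      from card_mono[OF _ this] show ?thesis by simp
    next
      assume "{j. j < N \<and> part n j = p} \<subseteq> {2 * n + 1..4 * n}"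
      from card_mono[OF _ this] show ?thesis by simp
    qed
  qed
  ultimately show False by (metis add_le_same_cancel1 le_trans not_one_le_zero)
qed

lemma hajos_fan_lower:
  assumes "n \<ge> 1" "ramsey_bound hajos_graph (fan_graph n) N"
  shows "4 * n + 2 \<le> N"
proof (rule ccontr)
  assume "\<not> ?thesis"
  then have N: "N \<le> 4 * n + 1" by simp
  have "simple_graph (tripartite_graph n N)" "card (verts (tripartite_graph n N)) = N"
    by (auto simp: simple_graph_def tripartite_graph_def nsets_def card_insert_if)
  then show False
    using assms(2) tripartite_no_hajos tripartite_complement_no_fan[OF assms(1) N]
    unfolding ramsey_bound_def by blast
qed

theorem theorem2:
  fixes n :: nat
  assumes "n \<ge> 111"
  shows "ramsey_number hajos_graph (fan_graph n) = 4 * n + 2"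
  unfolding ramsey_number_def
proof (rule Least_equality)
  show "4 * n + 2 > 0 \<and> ramsey_bound hajos_graph (fan_graph n) (4 * n + 2)"
    using hajos_fan_upper[OF assms] by simp
  show "4 * n + 2 \<le> N" if "N > 0 \<and> ramsey_bound hajos_graph (fan_graph n) N" for N
    using hajos_fan_lower[of n N] that assms by simp
qed

end
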